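(* Let $\alpha\in[1,2]$. A probability law on $\mathbb{R}^d$ is $S\alpha S$ if and only if it can be obtained as a weak limit of a sequence of laws of (finite) sums of independent sub-Gaussian random vectors with the same characteristic exponent $\alpha$.
   Context: A random vector $\xi\in\mathbb{R}^d$ (or its law) is symmetric $\alpha$-stable ($S\alpha S$), $\alpha\in(0,2]$, if $\xi$ has the same distribution as $-\xi$ and $a^{1/\alpha}\xi_1+b^{1/\alpha}\xi_2$ has the same distribution as $(a+b)^{1/\alpha}\xi$ for all $a,b>0$, where $\xi_1,\xi_2$ are independent copies of $\xi$. A random vector is sub-Gaussian with characteristic exponent $\alpha$ if its characteristic function is $\exp\{-\|u\|_E^\alpha\}$, where $\|u\|_E=\inf\{s\ge0:u\in sE\}$ is the Minkowski functional of a centred ellipsoid $E$ in $\mathbb{R}^d$, equivalently if it equals $\exp\{-\langle Cu,u\rangle^{\alpha/2}\}$ for a symmetric positive definite matrix $C$. *)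

theory Defs
  imports "HOL-Probability.Probability"
begin

definition prob_law :: "(real ^ 'd) measure \<Rightarrow> bool" where
  "prob_law \<mu> \<longleftrightarrow> prob_space \<mu> \<and> sets \<mu> = sets borel"

text \<open>Independent copies \<open>\<xi>\<^sub>1, \<xi>\<^sub>2\<close> of a vector with law \<open>\<mu>\<close> are realised as the coordinates
  of the product space \<open>\<mu> \<Otimes>\<^sub>M \<mu>\<close>.\<close>

definition sym_stable :: "real \<Rightarrow> (real ^ 'd) measure \<Rightarrow> bool" where
  "sym_stable \<alpha> \<mu> \<longleftrightarrow>
     distr \<mu> borel uminus = \<mu> \<and>
     (\<forall>a>0. \<forall>b>0.
        distr (\<mu> \<Otimes>\<^sub>M \<mu>) borel (\<lambda>(x, y). (a powr (1 / \<alpha>)) *\<^sub>R x + (b powr (1 / \<alpha>)) *\<^sub>R y)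
        = distr \<mu> borel (\<lambda>x. ((a + b) powr (1 / \<alpha>)) *\<^sub>R x))"

definition char_fun :: "(real ^ 'd) measure \<Rightarrow> real ^ 'd \<Rightarrow> complex" where
  "char_fun \<mu> u = (CLINT x|\<mu>. iexp (u \<bullet> x))"

definition centred_ellipsoid :: "(real ^ 'd) set \<Rightarrow> bool" where
  "centred_ellipsoid E \<longleftrightarrow> (\<exists>A :: real ^ 'd \<Rightarrow> real ^ 'd. linear A \<and> bij A \<and> E = A ` cball 0 1)"

definition minkowski_functional :: "(real ^ 'd) set \<Rightarrow> real ^ 'd \<Rightarrow> real" where
  "minkowski_functional E u = Inf {s. 0 \<le> s \<and> u \<in> (\<lambda>x. s *\<^sub>R x) ` E}"

definition sub_Gaussian :: "real \<Rightarrow> (real ^ 'd) measure \<Rightarrow> bool" where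
  "sub_Gaussian \<alpha> \<mu> \<longleftrightarrow> prob_law \<mu> \<and>
     (\<exists>E. centred_ellipsoid E \<and>
        (\<forall>u. char_fun \<mu> u = complex_of_real (exp (- (minkowski_functional E u powr \<alpha>)))))"

text \<open>The law of \<open>\<xi>\<^sub>0 + \<dots> + \<xi>\<^bsub>n-1\<^esub>\<close> for independent \<open>\<xi>\<^sub>i\<close> with laws \<open>\<mu> i\<close>: the joint law of
  independent vectors is the product of their laws, see \<open>indep_sum_law_eq\<close>.\<close>

definition indep_sum_law :: "nat \<Rightarrow> (nat \<Rightarrow> (real ^ 'd) measure) \<Rightarrow> (real ^ 'd) measure" where
  "indep_sum_law n \<mu> = distr (\<Pi>\<^sub>M i\<in>{..<n}. \<mu> i) borel (\<lambda>x. \<Sum>i<n. x i)"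

lemma (in prob_space) indep_sum_law_eq:
  fixes X :: "nat \<Rightarrow> 'a \<Rightarrow> real ^ 'd"
  assumes "indep_vars (\<lambda>_. borel) X {..<n}" and "n > 0"
  shows "distr M borel (\<lambda>\<omega>. \<Sum>i<n. X i \<omega>) = indep_sum_law n (\<lambda>i. distr M borel (X i))"
proof -
  have rv [measurable]: "X i \<in> borel_measurable M" if "i < n" for i
    using assms(1) that by (auto simp: indep_vars_def)
  have "(\<Pi>\<^sub>M i\<in>{..<n}. distr M borel (X i)) =
      distr M (\<Pi>\<^sub>M i\<in>{..<n}. borel) (\<lambda>x. \<lambda>i\<in>{..<n}. X i x)"
    using assms rv by (subst (asm) indep_vars_iff_distr_eq_PiM') auto
  then have "indep_sum_law n (\<lambda>i. distr M borel (X i)) =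
      distr (distr M (\<Pi>\<^sub>M i\<in>{..<n}. borel) (\<lambda>x. \<lambda>i\<in>{..<n}. X i x)) borel (\<lambda>x. \<Sum>i<n. x i)"
    by (simp add: indep_sum_law_def)
  also have "\<dots> = distr M borel ((\<lambda>x. \<Sum>i<n. x i) \<circ> (\<lambda>x. \<lambda>i\<in>{..<n}. X i x))"
    by (rule distr_distr) (auto intro!: borel_measurable_sum measurable_component_singleton)
  also have "\<dots> = distr M borel (\<lambda>\<omega>. \<Sum>i<n. X i \<omega>)"
    by (rule distr_cong) (auto simp: intro!: sum.cong)
  finally show ?thesis by simp
qed

definition sub_Gaussian_sum :: "real \<Rightarrow> (real ^ 'd) measure \<Rightarrow> bool" where
  "sub_Gaussian_sum \<alpha> \<nu> \<longleftrightarrow>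
     (\<exists>n \<mu>. n > 0 \<and> (\<forall>i<n. sub_Gaussian \<alpha> (\<mu> i)) \<and> \<nu> = indep_sum_law n \<mu>)"

text \<open>The weak convergence \<open>weak_conv_m\<close> of the library is restricted to laws on the real line.\<close>

definition weak_limit :: "(nat \<Rightarrow> (real ^ 'd) measure) \<Rightarrow> (real ^ 'd) measure \<Rightarrow> bool" where
  "weak_limit \<nu> \<mu> \<longleftrightarrow>
     (\<forall>f :: real ^ 'd \<Rightarrow> real. continuous_on UNIV f \<and> bounded (range f) \<longrightarrow>
        (\<lambda>k. LINT x|\<nu> k. f x) \<longlonglongrightarrow> (LINT x|\<mu>. f x))"

end

theory Submission
  imports Defs "HOL-Real_Asymp.Real_Asymp"
begin

text \<open>
  A law is \<open>S\<alpha>S\<close> exactly if its characteristic function is even and satisfies the multiplicative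
  equation \<open>\<phi>(a\<^sup>1\<^sup>/\<^sup>\<alpha> u) \<phi>(b\<^sup>1\<^sup>/\<^sup>\<alpha> u) = \<phi>((a + b)\<^sup>1\<^sup>/\<^sup>\<alpha> u)\<close> (\<open>sym_stable_iff_char_fun\<close>). This
  equation holds for \<open>exp (- g)\<close> with \<open>g\<close> homogeneous of degree \<open>\<alpha>\<close>, hence for sums of
  sub-Gaussian vectors, and it survives pointwise limits. That settles one direction
  (\<open>limit_imp_sym_stable\<close>).

  For the other direction let \<open>X\<close> be \<open>S\<alpha>S\<close>. Solving the equation gives a characteristic function
  \<open>exp (- f)\<close> with \<open>f \<ge> 0\<close> homogeneous of degree \<open>\<alpha>\<close> (\<open>stable_exponent\<close>). The point is to write
  \<open>f\<close> as a limit of sums of terms \<open>\<bar>\<langle>u, w\<rangle>\<bar>\<^sup>\<alpha>\<close>. Absolute moments do this without any canonical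
  representation of infinitely divisible laws: for \<open>p < \<alpha>\<close>, integrating \<open>1 - \<phi>(r u)\<close> against
  \<open>r\<^sup>-\<^sup>1\<^sup>-\<^sup>p dr\<close> in two ways yields \<open>f(u)\<^sup>p\<^sup>/\<^sup>\<alpha> = C\<^sub>p E \<bar>\<langle>u, X\<rangle>\<bar>\<^sup>p\<close> (\<open>stable_moment\<close>). The right-hand
  side is an integral of \<open>\<bar>\<langle>u, s\<rangle>\<bar>\<^sup>p\<close> over directions \<open>s\<close> in the unit sphere, against measures whose
  masses \<open>C\<^sub>p E \<bar>X\<bar>\<^sup>p\<close> stay bounded as \<open>p\<close> increases to \<open>\<alpha>\<close>. So \<open>p\<close> may be replaced by \<open>\<alpha>\<close> inside
  the integral and the directions may be rounded to a finite grid (\<open>stable_exponent_approx\<close>).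
  A term \<open>\<bar>\<langle>u, w\<rangle>\<bar>\<^sup>\<alpha>\<close> belongs to a degenerate ellipsoid, and adding a small multiple of the
  identity to the quadratic form makes it a genuine one (\<open>thin_ellipsoid_powr\<close>).

  Two general facts have to be supplied. The first is the passage between weak convergence and
  characteristic functions in several dimensions (\<open>levy_continuity_vec\<close>, \<open>char_fun_unique\<close>),
  obtained from the one-dimensional continuity theorem, which gives tightness, and from uniform
  approximation by trigonometric polynomials. The second is the existence of sub-Gaussian laws
  (\<open>sub_Gaussian_exists\<close>): a Gaussian vector with a random variance that has a positive stable
  law, the latter being a limit point of normalised sums of heavy-tailed variables.
\<close>

section \<open>Characteristic functions of vectors\<close>

lemma prob_law_space: "prob_law \<mu> \<Longrightarrow> space \<mu> = UNIV"
  unfolding prob_law_def by (metis sets_eq_imp_space_eq space_borel)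

lemma measurable_prob_law: "prob_law \<mu> \<Longrightarrow> f \<in> borel_measurable borel \<Longrightarrow> f \<in> borel_measurable \<mu>"
  unfolding prob_law_def by (metis measurable_cong_sets)

lemma prob_law_integrable:
  fixes f :: "real ^ 'd \<Rightarrow> 'b :: {banach, second_countable_topology}"
  assumes "prob_law \<mu>" and "continuous_on UNIV f" and "bounded (range f)"
  shows "integrable \<mu> f"
proof -
  interpret prob_space \<mu> using assms(1) by (simp add: prob_law_def)
  obtain B where "\<And>x. norm (f x) \<le> B" using assms(3) by (auto simp: bounded_iff)
  then show ?thesis
    by (intro integrable_const_bound[of _ B] measurable_prob_law[OF assms(1)]
        borel_measurable_continuous_onI[OF assms(2)]) auto
qed

lemma prob_law_integrable_iexp: "prob_law \<mu> \<Longrightarrow> integrable \<mu> (\<lambda>x. iexp (u \<bullet> x))"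
  by (rule prob_law_integrable) (auto intro!: continuous_intros boundedI[of _ 1])

text \<open>One-dimensional theory applies to a vector through its projections.\<close>

lemma real_distribution_inner:
  assumes "prob_law \<mu>"
  shows "real_distribution (distr \<mu> borel ((\<bullet>) u))"
proof -
  interpret prob_space \<mu> using assms by (simp add: prob_law_def)
  have "((\<bullet>) u) \<in> borel_measurable \<mu>" by (rule measurable_prob_law[OF assms]) simp
  then show ?thesis
    by (auto simp: real_distribution_def real_distribution_axioms_def intro: prob_space_distr)
qed

lemma char_distr_inner:
  assumes "prob_law \<mu>"
  shows "char (distr \<mu> borel ((\<bullet>) u)) t = char_fun \<mu> (t *\<^sub>R u)"
proof -
  have "((\<bullet>) u) \<in> borel_measurable \<mu>" by (rule measurable_prob_law[OF assms]) simp
  then show ?thesis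
    unfolding char_def char_fun_def by (subst integral_distr) auto
qed

lemma char_fun_Re_Im:
  assumes "prob_law \<mu>"
  shows "Re (char_fun \<mu> u) = (LINT x|\<mu>. cos (u \<bullet> x))"
    and "Im (char_fun \<mu> u) = (LINT x|\<mu>. sin (u \<bullet> x))"
  unfolding char_fun_def integral_Re[OF prob_law_integrable_iexp[OF assms], symmetric]
    integral_Im[OF prob_law_integrable_iexp[OF assms], symmetric]
  by (simp_all add: Re_exp Im_exp)

section \<open>The continuity theorem in several dimensions\<close>

text \<open>Real trigonometric polynomials. The phase \<open>b\<close> covers sines, so that one kind of generator is
  enough, and the product formula for cosines keeps the class closed under products.\<close>

inductive trig_poly :: "(real ^ 'd \<Rightarrow> real) \<Rightarrow> bool" where
  wave: "trig_poly (\<lambda>x. c * cos (u \<bullet> x + b))"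
| add: "trig_poly f \<Longrightarrow> trig_poly g \<Longrightarrow> trig_poly (\<lambda>x. f x + g x)"

lemma trig_poly_const: "trig_poly (\<lambda>x. c)"
  using trig_poly.wave[of c 0 0] by simp

lemma trig_poly_continuous: "trig_poly f \<Longrightarrow> continuous_on UNIV f"
  by (induction rule: trig_poly.induct) (auto intro!: continuous_intros)

lemma trig_poly_bounded: "trig_poly f \<Longrightarrow> bounded (range f)"
proof (induction rule: trig_poly.induct)
  case (wave c u b)
  then show ?case
    by (intro boundedI[of _ "\<bar>c\<bar>"]) (auto simp: abs_mult intro!: mult_left_le)
next
  case (add f g)
  obtain B C where "\<And>x. \<bar>f x\<bar> \<le> B" "\<And>x. \<bar>g x\<bar> \<le> C"
    using add.IH by (auto simp: bounded_iff)
  then show ?case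
    by (intro boundedI[of _ "B + C"]) (auto intro: order_trans[OF abs_triangle_ineq add_mono])
qed

lemma trig_poly_mult_wave: "trig_poly f \<Longrightarrow> trig_poly (\<lambda>x. f x * (c * cos (u \<bullet> x + b)))"
proof (induction rule: trig_poly.induct)
  case (wave d v a)
  have "trig_poly (\<lambda>x. d * c / 2 * cos ((v - u) \<bullet> x + (a - b)) + d * c / 2 * cos ((v + u) \<bullet> x + (a + b)))"
    by (intro trig_poly.intros)
  moreover have "d * c / 2 * cos ((v - u) \<bullet> x + (a - b)) + d * c / 2 * cos ((v + u) \<bullet> x + (a + b))
      = d * cos (v \<bullet> x + a) * (c * cos (u \<bullet> x + b))" for x
  proof -
    have "cos (v \<bullet> x + a) * cos (u \<bullet> x + b)
        = (cos ((v \<bullet> x + a) - (u \<bullet> x + b)) + cos ((v \<bullet> x + a) + (u \<bullet> x + b))) / 2"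
      by (rule cos_times_cos)
    also have "(v \<bullet> x + a) - (u \<bullet> x + b) = (v - u) \<bullet> x + (a - b)" by (simp add: algebra_simps)
    also have "(v \<bullet> x + a) + (u \<bullet> x + b) = (v + u) \<bullet> x + (a + b)" by (simp add: algebra_simps)
    finally show ?thesis by (simp add: field_simps)
  qed
  ultimately show ?case by simp
next
  case (add f g)
  then show ?case by (simp add: distrib_right trig_poly.add)
qed

lemma trig_poly_mult: "trig_poly g \<Longrightarrow> trig_poly f \<Longrightarrow> trig_poly (\<lambda>x. f x * g x)"
  by (induction rule: trig_poly.induct) (auto simp: trig_poly_mult_wave distrib_left trig_poly.add)

lemma trig_poly_polynomial:
  assumes "real_polynomial_function q" and "trig_poly f"
  shows "trig_poly (\<lambda>x. q (f x))"
  using assms(1)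
proof (induction rule: real_polynomial_function.induct)
  case (linear h)
  have h: "h t = t * h 1" for t
    using linear_cmul[OF bounded_linear.linear[OF linear], of t 1] by simp
  have "(\<lambda>x. h (f x)) = (\<lambda>x. f x * h 1)" by (rule ext) (rule h)
  then show ?case using trig_poly_mult[OF trig_poly_const assms(2), of "h 1"] by metis
next
  case (const c)
  show ?case by (rule trig_poly_const)
next
  case (add h k)
  show ?case by (rule trig_poly.add[OF add.IH])
next
  case (mult h k)
  show ?case by (rule trig_poly_mult[OF mult.IH(2) mult.IH(1)])
qed

lemma trig_poly_integral_tendsto:
  assumes laws: "\<And>k. prob_law (\<nu> k)" "prob_law \<mu>"
    and char: "\<And>u. (\<lambda>k. char_fun (\<nu> k) u) \<longlonglongrightarrow> char_fun \<mu> u"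
    and "trig_poly g"
  shows "(\<lambda>k. LINT x|\<nu> k. g x) \<longlonglongrightarrow> (LINT x|\<mu>. g x)"
  using assms(4)
proof (induction rule: trig_poly.induct)
  case (wave c u b)
  have wave_int: "(LINT x|\<rho>. c * cos (u \<bullet> x + b)) = c * Re (cis b * char_fun \<rho> u)"
    if "prob_law \<rho>" for \<rho> :: "(real ^ 'a) measure"
  proof -
    have "integrable \<rho> (\<lambda>x. cos (u \<bullet> x))" "integrable \<rho> (\<lambda>x. sin (u \<bullet> x))"
      by (rule prob_law_integrable[OF that]; auto intro!: continuous_intros boundedI[of _ 1])+
    then show ?thesis
      by (simp add: cos_add char_fun_Re_Im[OF that] mult.commute)
  qed
  have "(\<lambda>k. c * Re (cis b * char_fun (\<nu> k) u)) \<longlonglongrightarrow> c * Re (cis b * char_fun \<mu> u)"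
    by (intro tendsto_intros char)
  then show ?case unfolding wave_int[OF laws(1)] wave_int[OF laws(2)] .
next
  case (add f g)
  have "integrable \<rho> f" "integrable \<rho> g" if "prob_law \<rho>" for \<rho>
    using that add.hyps by (auto intro: prob_law_integrable trig_poly_continuous trig_poly_bounded)
  then show ?case using tendsto_add[OF add.IH] laws by simp
qed

lemma trig_poly_separates:
  fixes x y :: "real ^ 'd"
  assumes "x \<noteq> y"
  shows "\<exists>f. trig_poly f \<and> f x \<noteq> f y"
proof -
  define u where "u = (1 / (norm (x - y))\<^sup>2) *\<^sub>R (x - y)"
  have "u \<bullet> x + - (u \<bullet> y) = u \<bullet> (x - y)" by (simp add: inner_diff_right)
  also have "\<dots> = 1" using assms by (simp add: u_def power2_norm_eq_inner)
  finally have "1 * cos (u \<bullet> x + - (u \<bullet> y)) \<noteq> 1 * cos (u \<bullet> y + - (u \<bullet> y))"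
    using cos_monotone_0_pi[of 0 1] pi_gt3 by simp
  then show ?thesis using trig_poly.wave[of 1 u "- (u \<bullet> y)"] by blast
qed

text \<open>The Stone-Weierstrass theorem controls the approximant on the compact set \<open>K\<close> only. For weak
  convergence it must also be bounded on the rest of the space, uniformly in the accuracy.
  Composing it with a polynomial that approximates the truncation at level \<open>C\<close> achieves this and
  stays among trigonometric polynomials.\<close>

lemma trig_poly_approx:
  fixes f :: "real ^ 'd \<Rightarrow> real"
  assumes "compact K" and f: "continuous_on K f" and C: "\<And>x. \<bar>f x\<bar> \<le> C" and "0 < e"
  obtains g where "trig_poly g" and "\<And>x. x \<in> K \<Longrightarrow> \<bar>f x - g x\<bar> \<le> e" and "\<And>x. \<bar>g x\<bar> \<le> C + e"
proof -
  have "\<exists>p. trig_poly p \<and> (\<forall>x\<in>K. \<bar>f x - p x\<bar> < e / 2)"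
  proof (rule Stone_Weierstrass_HOL)
    show "continuous_on K p" if "trig_poly p" for p
      using trig_poly_continuous[OF that] by (rule continuous_on_subset) simp
  qed (use assms trig_poly_separates in \<open>auto intro: trig_poly_const trig_poly.add trig_poly_mult\<close>)
  then obtain p where p: "trig_poly p" "\<And>x. x \<in> K \<Longrightarrow> \<bar>f x - p x\<bar> < e / 2" by blast
  obtain M where M: "\<And>x. \<bar>p x\<bar> \<le> M" using trig_poly_bounded[OF p(1)] by (auto simp: bounded_iff)
  \<comment> \<open>Truncation keeps the approximation on \<open>K\<close>, where \<open>f\<close> already takes values in \<open>[-C, C]\<close>.\<close>
  have "continuous_on {-M..M} (\<lambda>t. max (-C) (min C t))"
    by (intro continuous_intros)
  from Stone_Weierstrass_real_polynomial_function[OF compact_Icc this, of "e / 2"] \<open>0 < e\<close>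
  obtain q where q: "real_polynomial_function q"
    "\<And>t. t \<in> {-M..M} \<Longrightarrow> \<bar>max (-C) (min C t) - q t\<bar> < e / 2"
    by auto
  have pM: "p x \<in> {-M..M}" for x using M[of x] by (auto simp: abs_le_iff)
  have near: "\<bar>a - c\<bar> < e / 2 \<Longrightarrow> \<bar>c - b\<bar> < e / 2 \<Longrightarrow> \<bar>a - b\<bar> \<le> e" for a b c
    by linarith
  have bound: "\<bar>c\<bar> \<le> C \<Longrightarrow> \<bar>c - b\<bar> < e / 2 \<Longrightarrow> \<bar>b\<bar> \<le> C + e" for b c
    using \<open>0 < e\<close> by linarith
  show ?thesis
  proof
    show "trig_poly (\<lambda>x. q (p x))" by (rule trig_poly_polynomial[OF q(1) p(1)])
    show "\<bar>f x - q (p x)\<bar> \<le> e" if "x \<in> K" for x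
    proof -
      have "\<bar>f x - max (-C) (min C (p x))\<bar> \<le> \<bar>f x - p x\<bar>"
        using C[of x] by (auto simp: max_def min_def abs_le_iff)
      then have "\<bar>f x - max (-C) (min C (p x))\<bar> < e / 2" using p(2)[OF that] by (rule le_less_trans)
      with q(2)[OF pM[of x]] show ?thesis
        using near[of "f x" "max (-C) (min C (p x))" "q (p x)"] by blast
    qed
    show "\<bar>q (p x)\<bar> \<le> C + e" for x
    proof -
      have "\<bar>max (-C) (min C (p x))\<bar> \<le> C"
        using C[of x] by (auto simp: max_def min_def abs_le_iff)
      with q(2)[OF pM[of x]] show ?thesis
        using bound[of "max (-C) (min C (p x))" "q (p x)"] by blast
    qed
  qed
qed

definition tail_cutoff :: "real \<Rightarrow> real \<Rightarrow> real" where
  "tail_cutoff R t = max 0 (min 1 (\<bar>t\<bar> - R))"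

lemma tail_cutoff_continuous: "continuous_on S (tail_cutoff R)"
  unfolding tail_cutoff_def by (auto intro!: continuous_intros)

lemma tail_cutoff_bounds: "0 \<le> tail_cutoff R t" "tail_cutoff R t \<le> 1"
  by (auto simp: tail_cutoff_def)

lemma tail_cutoff_integral_small:
  assumes "real_distribution M" and "0 < e"
  shows "\<exists>R0. \<forall>R\<ge>R0. (LINT t|M. tail_cutoff R t) < e"
proof -
  interpret real_distribution M by fact
  have [measurable]: "tail_cutoff R \<in> borel_measurable borel" for R
    by (rule borel_measurable_continuous_onI[OF tail_cutoff_continuous])
  have "((\<lambda>R. LINT t|M. tail_cutoff R t) \<longlongrightarrow> (LINT t|M. 0)) at_top"
  proof (rule integral_dominated_convergence_at_top[where w = "\<lambda>_. 1"])
    show "AE t in M. ((\<lambda>R. tail_cutoff R t) \<longlongrightarrow> 0) at_top"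
    proof (rule AE_I2, rule tendsto_eventually)
      show "\<forall>\<^sub>F R in at_top. tail_cutoff R t = 0" for t
        using eventually_ge_at_top[of "\<bar>t\<bar>"] by eventually_elim (auto simp: tail_cutoff_def)
    qed
    show "\<forall>\<^sub>F R in at_top. AE t in M. norm (tail_cutoff R t) \<le> 1"
      by (auto simp: tail_cutoff_bounds)
  qed (auto intro: borel_measurable_const)
  then have "\<forall>\<^sub>F R in at_top. (LINT t|M. tail_cutoff R t) < e"
    using \<open>0 < e\<close> by (auto dest!: order_tendstoD)
  then show ?thesis by (auto simp: eventually_at_top_linorder)
qed

text \<open>Integrals of trigonometric polynomials converge by hypothesis. A bounded continuous function is
  uniformly close to such a polynomial on a large box and differs from it by a bounded amount
  elsewhere. The mass outside the box is dominated by the sum of the cutoffs of the coordinates,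
  whose integrals converge by the one-dimensional theorem.\<close>

lemma levy_continuity_vec:
  fixes \<nu> :: "nat \<Rightarrow> (real ^ 'd) measure" and \<mu> :: "(real ^ 'd) measure"
  assumes laws: "\<And>k. prob_law (\<nu> k)" "prob_law \<mu>"
    and char: "\<And>u. (\<lambda>k. char_fun (\<nu> k) u) \<longlonglongrightarrow> char_fun \<mu> u"
  shows "weak_limit \<nu> \<mu>"
  unfolding weak_limit_def
proof (intro allI impI, elim conjE)
  fix f :: "real ^ 'd \<Rightarrow> real"
  assume f: "continuous_on UNIV f" "bounded (range f)"
  obtain C where "0 < C" and C: "\<And>x. \<bar>f x\<bar> \<le> C"
    using f(2) by (auto simp: bounded_pos)
  show "(\<lambda>k. LINT x|\<nu> k. f x) \<longlonglongrightarrow> (LINT x|\<mu>. f x)"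
  proof (rule LIMSEQ_I)
    fix r :: real assume "0 < r"
    \<comment> \<open>Outside the box the error is at most \<open>2 * C + e \<le> 3 * C\<close>, and \<open>e + 3 * C * \<eta> \<le> r / 3\<close>.\<close>
    define e where "e = min C (r / 6)"
    have "0 < e" using \<open>0 < r\<close> \<open>0 < C\<close> by (simp add: e_def)
    define d where "d = real CARD('d)"
    have "0 < d" by (simp add: d_def)
    define \<eta> where "\<eta> = r / (18 * C)"
    have "0 < \<eta>" using \<open>0 < r\<close> \<open>0 < C\<close> by (simp add: \<eta>_def)
    \<comment> \<open>The coordinates converge weakly, and this makes the laws uniformly tight.\<close>
    have "\<exists>R0. \<forall>R\<ge>R0. (LINT t|distr \<mu> borel ((\<bullet>) (axis i 1)). tail_cutoff R t) < \<eta> / d" for i :: 'd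
      using \<open>0 < \<eta>\<close> \<open>0 < d\<close> by (intro tail_cutoff_integral_small real_distribution_inner laws) auto
    then obtain R0 where R0: "\<And>i :: 'd. \<And>R. R \<ge> R0 i \<Longrightarrow>
        (LINT t|distr \<mu> borel ((\<bullet>) (axis i 1)). tail_cutoff R t) < \<eta> / d" by metis
    define R where "R = Max (range R0)"
    have R: "(LINT t|distr \<mu> borel ((\<bullet>) (axis i 1)). tail_cutoff R t) < \<eta> / d" for i :: 'd
      by (rule R0) (simp add: R_def)
    define H where "H x = (\<Sum>i\<in>UNIV. tail_cutoff R (x $ i))" for x :: "real ^ 'd"
    have coord: "(LINT t|distr \<rho> borel ((\<bullet>) (axis i 1)). tail_cutoff R t) = (LINT x|\<rho>. tail_cutoff R (x $ i))"
      if "prob_law \<rho>" for \<rho> :: "(real ^ 'd) measure" and i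
    proof -
      have "((\<bullet>) (axis i 1)) \<in> borel_measurable \<rho>" by (rule measurable_prob_law[OF that]) simp
      then show ?thesis
        by (subst integral_distr)
          (auto simp: inner_axis' intro!: borel_measurable_continuous_onI tail_cutoff_continuous)
    qed
    have int_tail: "integrable \<rho> (\<lambda>x. tail_cutoff R (x $ i))"
      if "prob_law \<rho>" for \<rho> :: "(real ^ 'd) measure" and i
      by (rule prob_law_integrable[OF that])
        (auto intro!: boundedI[of _ 1] continuous_on_compose2[OF tail_cutoff_continuous]
          continuous_intros simp: tail_cutoff_bounds)
    have int_H: "integrable \<rho> H" "(LINT x|\<rho>. H x) = (\<Sum>i\<in>UNIV. LINT x|\<rho>. tail_cutoff R (x $ i))"
      if "prob_law \<rho>" for \<rho> :: "(real ^ 'd) measure"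
      unfolding H_def using int_tail[OF that] by auto
    have "(LINT x|\<mu>. H x) < (\<Sum>i\<in>(UNIV :: 'd set). \<eta> / d)"
      unfolding int_H(2)[OF laws(2)]
      by (rule sum_strict_mono) (use R coord[OF laws(2)] in auto)
    then have H\<mu>: "(LINT x|\<mu>. H x) < \<eta>" using \<open>0 < d\<close> by (simp add: d_def)
    have "(\<lambda>k. LINT x|\<nu> k. H x) \<longlonglongrightarrow> (LINT x|\<mu>. H x)"
      unfolding int_H(2)[OF laws(1)] int_H(2)[OF laws(2)]
    proof (rule tendsto_sum)
      fix i :: 'd
      have "weak_conv_m (\<lambda>k. distr (\<nu> k) borel ((\<bullet>) (axis i 1))) (distr \<mu> borel ((\<bullet>) (axis i 1)))"
        by (intro levy_continuity real_distribution_inner laws) (simp add: char_distr_inner laws char)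
      then have "(\<lambda>k. LINT t|distr (\<nu> k) borel ((\<bullet>) (axis i 1)). tail_cutoff R t)
          \<longlonglongrightarrow> (LINT t|distr \<mu> borel ((\<bullet>) (axis i 1)). tail_cutoff R t)"
      proof (rule weak_conv_imp_integral_bdd_continuous_conv[rotated 2])
        show "isCont (tail_cutoff R) t" for t
          using tail_cutoff_continuous[of UNIV R] by (simp add: continuous_on_eq_continuous_at)
        show "norm (tail_cutoff R t) \<le> 1" for t by (simp add: tail_cutoff_bounds)
      qed (intro real_distribution_inner laws)+
      then show "(\<lambda>k. LINT x|\<nu> k. tail_cutoff R (x $ i)) \<longlonglongrightarrow> (LINT x|\<mu>. tail_cutoff R (x $ i))"
        by (simp add: coord laws)
    qed
    then have ev_H: "\<forall>\<^sub>F k in sequentially. (LINT x|\<nu> k. H x) < \<eta>"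
      using H\<mu> by (rule order_tendstoD)
    \<comment> \<open>The unit margin in the box is where the cutoff climbs from 0 to 1.\<close>
    define K :: "(real ^ 'd) set" where "K = cbox (\<chi> i. - (R + 1)) (\<chi> i. R + 1)"
    obtain g where g: "trig_poly g" "\<And>x. x \<in> K \<Longrightarrow> \<bar>f x - g x\<bar> \<le> e" "\<And>x. \<bar>g x\<bar> \<le> C + e"
    proof (rule trig_poly_approx[of K f C e])
      show "compact K" by (simp add: K_def)
      show "continuous_on K f" using f(1) by (rule continuous_on_subset) simp
    qed (use C \<open>0 < e\<close> in auto)
    have H0: "H x \<ge> 0" for x unfolding H_def by (intro sum_nonneg tail_cutoff_bounds)
    have pointwise: "\<bar>f x - g x\<bar> \<le> e + 3 * C * H x" for x
    proof (cases "x \<in> K")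
      case True
      then show ?thesis using g(2)[of x] H0[of x] \<open>0 < C\<close> by (simp add: add_increasing2)
    next
      case False
      have "x \<in> K" if bd: "\<And>i. \<bar>x $ i\<bar> \<le> R + 1"
      proof -
        have "- (R + 1) \<le> x $ i" "x $ i \<le> R + 1" for i
          using bd[of i] by linarith+
        then show ?thesis unfolding K_def mem_box_cart vec_lambda_beta by blast
      qed
      then obtain i where i: "R + 1 < \<bar>x $ i\<bar>" using False not_le by blast
      have "tail_cutoff R (x $ i) \<le> H x"
        unfolding H_def by (rule member_le_sum) (auto simp: tail_cutoff_bounds)
      moreover have "tail_cutoff R (x $ i) = 1" using i by (simp add: tail_cutoff_def)
      ultimately have "3 * C * 1 \<le> 3 * C * H x" using \<open>0 < C\<close> by (intro mult_left_mono) auto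
      moreover have "\<bar>f x - g x\<bar> \<le> \<bar>f x\<bar> + \<bar>g x\<bar>" by (rule abs_triangle_ineq4)
      moreover have "e \<le> C" by (simp add: e_def)
      ultimately show ?thesis using \<open>0 < e\<close> C[of x] g(3)[of x] by linarith
    qed
    have close: "\<bar>(LINT x|\<rho>. f x) - (LINT x|\<rho>. g x)\<bar> \<le> r / 3"
      if "prob_law \<rho>" "(LINT x|\<rho>. H x) < \<eta>" for \<rho> :: "(real ^ 'd) measure"
    proof -
      interpret prob_space \<rho> using that(1) by (simp add: prob_law_def)
      have I: "integrable \<rho> f" "integrable \<rho> g" "integrable \<rho> H"
        using prob_law_integrable[OF that(1)] f g(1) trig_poly_continuous trig_poly_bounded
          int_H(1)[OF that(1)] by blast+
      have "\<bar>(LINT x|\<rho>. f x) - (LINT x|\<rho>. g x)\<bar> = \<bar>LINT x|\<rho>. f x - g x\<bar>" using I by simp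
      also have "\<dots> \<le> (LINT x|\<rho>. \<bar>f x - g x\<bar>)" by (rule integral_abs_bound)
      also have "\<dots> \<le> (LINT x|\<rho>. e + 3 * C * H x)"
        using I pointwise by (intro integral_mono) auto
      also have "\<dots> = e + 3 * C * (LINT x|\<rho>. H x)" using I by (simp add: prob_space)
      also have "\<dots> \<le> r / 6 + 3 * C * \<eta>"
        using that(2) \<open>0 < C\<close> by (intro add_mono mult_left_mono) (auto simp: e_def)
      also have "\<dots> = r / 3" using \<open>0 < C\<close> by (simp add: \<eta>_def field_simps)
      finally show ?thesis .
    qed
    have "(\<lambda>k. LINT x|\<nu> k. g x) \<longlonglongrightarrow> (LINT x|\<mu>. g x)"
      by (rule trig_poly_integral_tendsto[OF laws char g(1)])
    then have g_near: "\<forall>\<^sub>F k in sequentially. \<bar>(LINT x|\<nu> k. g x) - (LINT x|\<mu>. g x)\<bar> < r / 3"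
      using \<open>0 < r\<close> by (auto dest: tendstoD[where e = "r / 3"] simp: dist_real_def)
    have three: "\<bar>a - b\<bar> \<le> r / 3 \<Longrightarrow> \<bar>a' - b'\<bar> \<le> r / 3 \<Longrightarrow> \<bar>b - b'\<bar> < r / 3 \<Longrightarrow> \<bar>a - a'\<bar> < r"
      for a b a' b' :: real by linarith
    from ev_H g_near have "\<forall>\<^sub>F k in sequentially. norm ((LINT x|\<nu> k. f x) - (LINT x|\<mu>. f x)) < r"
    proof eventually_elim
      case (elim k)
      show ?case
        unfolding real_norm_def
        using close[OF laws(1) elim(1)] close[OF laws(2) H\<mu>] elim(2) by (rule three)
    qed
    then show "\<exists>N. \<forall>k\<ge>N. norm ((LINT x|\<nu> k. f x) - (LINT x|\<mu>. f x)) < r"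
      by (simp add: eventually_sequentially)
  qed
qed

lemma weak_limitD:
  fixes f :: "real ^ 'd \<Rightarrow> real"
  shows "weak_limit \<nu> \<mu> \<Longrightarrow> continuous_on UNIV f \<Longrightarrow> bounded (range f)
    \<Longrightarrow> (\<lambda>k. LINT x|\<nu> k. f x) \<longlonglongrightarrow> (LINT x|\<mu>. f x)"
  by (simp add: weak_limit_def)

lemma weak_limit_char_fun:
  assumes laws: "\<And>k. prob_law (\<nu> k)" "prob_law \<mu>" and "weak_limit \<nu> \<mu>"
  shows "(\<lambda>k. char_fun (\<nu> k) u) \<longlonglongrightarrow> char_fun \<mu> u"
  unfolding tendsto_complex_iff char_fun_Re_Im[OF laws(1)] char_fun_Re_Im[OF laws(2)]
proof (intro conjI)
  have lim: "(\<lambda>k. LINT x|\<nu> k. f x) \<longlonglongrightarrow> (LINT x|\<mu>. f x)"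
    if "continuous_on UNIV f" "\<And>x. \<bar>f x\<bar> \<le> 1" for f :: "real ^ 'a \<Rightarrow> real"
    using that by (intro weak_limitD[OF assms(3)] boundedI[of _ 1]) auto
  show "(\<lambda>k. LINT x|\<nu> k. cos (u \<bullet> x)) \<longlonglongrightarrow> (LINT x|\<mu>. cos (u \<bullet> x))"
    "(\<lambda>k. LINT x|\<nu> k. sin (u \<bullet> x)) \<longlonglongrightarrow> (LINT x|\<mu>. sin (u \<bullet> x))"
    by (rule lim; auto intro!: continuous_intros)+
qed

text \<open>Equal characteristic functions give equal integrals of bounded continuous functions, by the
  continuity theorem for a constant sequence; those functions approximate the indicator of a
  closed set from above.\<close>

lemma char_fun_unique:
  fixes \<mu> \<nu> :: "(real ^ 'd) measure"
  assumes \<mu>: "prob_law \<mu>" and \<nu>: "prob_law \<nu>" and char: "\<And>u. char_fun \<mu> u = char_fun \<nu> u"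
  shows "\<mu> = \<nu>"
proof (rule measure_eqI_generator_eq[where \<Omega> = UNIV and E = "Collect closed" and A = "\<lambda>_. UNIV"])
  interpret \<mu>: prob_space \<mu> using \<mu> by (simp add: prob_law_def)
  interpret \<nu>: prob_space \<nu> using \<nu> by (simp add: prob_law_def)
  show "Int_stable (Collect closed :: (real ^ 'd) set set)" by (auto simp: Int_stable_def)
  show "sets \<mu> = sigma_sets UNIV (Collect closed)" "sets \<nu> = sigma_sets UNIV (Collect closed)"
    using \<mu> \<nu> by (simp_all add: prob_law_def borel_eq_closed)
  show "emeasure \<mu> UNIV \<noteq> \<infinity>" by simp
  fix S :: "(real ^ 'd) set" assume "S \<in> Collect closed"
  then have S: "closed S" by simp
  show "emeasure \<mu> S = emeasure \<nu> S"
  proof (cases "S = {}")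
    case False
    define h where "h n x = max 0 (1 - real n * infdist x S)" for n x
    have h_cont: "continuous_on UNIV (h n)" for n
      unfolding h_def by (auto intro!: continuous_intros)
    have h_bd: "0 \<le> h n x" "h n x \<le> 1" for n x
      by (auto simp: h_def infdist_nonneg)
    have h_lim: "(\<lambda>n. h n x) \<longlonglongrightarrow> indicator S x" for x
    proof (cases "x \<in> S")
      case True
      then show ?thesis by (simp add: h_def)
    next
      case F: False
      then have "infdist x S > 0"
        using infdist_pos_not_in_closed S False by blast
      then obtain n0 where n0: "1 < real n0 * infdist x S" using reals_Archimedean3 by blast
      have "h n x = 0" if "n \<ge> n0" for n
      proof -
        have "real n0 * infdist x S \<le> real n * infdist x S"
          using that by (intro mult_right_mono) (auto simp: infdist_nonneg)
        then show ?thesis using n0 by (simp add: h_def)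
      qed
      then have "\<forall>\<^sub>F n in sequentially. h n x = indicator S x"
        unfolding eventually_sequentially using F by (auto intro!: exI[of _ n0])
      then show ?thesis by (rule tendsto_eventually)
    qed
    have lim: "(\<lambda>n. LINT x|\<rho>. h n x) \<longlonglongrightarrow> measure \<rho> S" if "prob_law \<rho>" for \<rho>
    proof -
      interpret prob_space \<rho> using that by (simp add: prob_law_def)
      have [measurable]: "h n \<in> borel_measurable \<rho>" for n
        by (intro measurable_prob_law[OF that] borel_measurable_continuous_onI h_cont)
      have S\<rho> [measurable]: "S \<in> sets \<rho>" using that S by (simp add: prob_law_def)
      have "(\<lambda>n. LINT x|\<rho>. h n x) \<longlonglongrightarrow> (LINT x|\<rho>. indicator S x)"
        by (rule integral_dominated_convergence[where w = "\<lambda>_. 1"]) (auto simp: h_lim h_bd)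
      then show ?thesis using S\<rho> by (simp add: prob_law_space[OF that])
    qed
    have "weak_limit (\<lambda>_. \<mu>) \<nu>" by (rule levy_continuity_vec) (simp_all add: \<mu> \<nu> char)
    then have "(\<lambda>k::nat. LINT x|\<mu>. h n x) \<longlonglongrightarrow> (LINT x|\<nu>. h n x)" for n
      using h_bd by (intro weak_limitD h_cont boundedI[of _ 1]) auto
    then have "(LINT x|\<mu>. h n x) = (LINT x|\<nu>. h n x)" for n by (simp add: LIMSEQ_const_iff)
    then have "measure \<mu> S = measure \<nu> S" using lim[OF \<mu>] lim[OF \<nu>] LIMSEQ_unique by auto
    then show ?thesis by (simp add: \<mu>.emeasure_eq_measure \<nu>.emeasure_eq_measure)
  qed simp
qed auto

section \<open>Stable Levy measures\<close>

text \<open>The power law on the half-line that is, up to a constant, the Levy measure of the positive \<open>p\<close>-stable law for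
  \<open>p < 1\<close>, and the radial part of the Levy measure of symmetric \<open>p\<close>-stable laws for \<open>p < 2\<close>.
  What matters below is its behaviour under scaling, which turns integrals of \<open>h (c * r)\<close> into
  powers of \<open>c\<close>.\<close>

definition levy_measure :: "real \<Rightarrow> real measure" where
  "levy_measure p = density lborel (\<lambda>r. ennreal (r powr (- 1 - p)) * indicator {0<..} r)"

lemma sets_levy_measure [measurable_cong, simp]: "sets (levy_measure p) = sets borel"
  by (simp add: levy_measure_def)

lemma space_levy_measure [simp]: "space (levy_measure p) = UNIV"
  by (simp add: levy_measure_def)

lemma nn_integral_levy_measure:
  assumes [measurable]: "h \<in> borel_measurable borel"
  shows "(\<integral>\<^sup>+r. h r \<partial>levy_measure p)
      = (\<integral>\<^sup>+r. ennreal (r powr (- 1 - p)) * indicator {0<..} r * h r \<partial>lborel)"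
  unfolding levy_measure_def by (subst nn_integral_density) auto

lemma sigma_finite_levy_measure: "sigma_finite_measure (levy_measure p)"
  unfolding levy_measure_def
  by (subst sigma_finite_measure.sigma_finite_iff_density_finite[OF sigma_finite_lborel])
    (auto simp: indicator_def ennreal_mult_eq_top_iff)

lemma AE_levy_measure_pos: "AE r in levy_measure p. 0 < r"
  unfolding levy_measure_def by (subst AE_density) (auto simp: indicator_def)

lemma levy_measure_scale:
  assumes [measurable]: "h \<in> borel_measurable borel" and "0 < c"
  shows "(\<integral>\<^sup>+r. h (c * r) \<partial>levy_measure p) = ennreal (c powr p) * (\<integral>\<^sup>+r. h r \<partial>levy_measure p)"
proof -
  let ?g = "\<lambda>r. ennreal (r powr (- 1 - p)) * indicator {0<..} r * h r"
  have "(\<integral>\<^sup>+r. h r \<partial>levy_measure p) = (\<integral>\<^sup>+r. ?g r \<partial>lborel)"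
    by (rule nn_integral_levy_measure) simp
  also have "\<dots> = ennreal \<bar>c\<bar> * (\<integral>\<^sup>+r. ?g (0 + c * r) \<partial>lborel)"
    using \<open>0 < c\<close> by (intro nn_integral_real_affine) auto
  also have "(\<integral>\<^sup>+r. ?g (0 + c * r) \<partial>lborel)
      = (\<integral>\<^sup>+r. ennreal (c powr (- 1 - p)) * (ennreal (r powr (- 1 - p)) * indicator {0<..} r * h (c * r)) \<partial>lborel)"
    using \<open>0 < c\<close>
    by (intro nn_integral_cong)
      (auto simp: indicator_def powr_mult ennreal_mult zero_less_mult_iff mult.assoc)
  also have "\<dots> = ennreal (c powr (- 1 - p)) * (\<integral>\<^sup>+r. h (c * r) \<partial>levy_measure p)"
    by (subst nn_integral_cmult) (auto simp: nn_integral_levy_measure)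
  finally have "ennreal (c powr p) * (\<integral>\<^sup>+r. h r \<partial>levy_measure p)
      = ennreal (c powr p) * (ennreal \<bar>c\<bar> * (ennreal (c powr (- 1 - p)) * (\<integral>\<^sup>+r. h (c * r) \<partial>levy_measure p)))"
    by simp
  also have "\<dots> = ennreal (c powr p * \<bar>c\<bar> * c powr (- 1 - p)) * (\<integral>\<^sup>+r. h (c * r) \<partial>levy_measure p)"
    by (simp add: ennreal_mult mult.assoc)
  also have "c powr p * \<bar>c\<bar> * c powr (- 1 - p) = c powr (p + 1 + (- 1 - p))"
    using \<open>0 < c\<close> by (simp only: powr_add) simp
  also have "\<dots> = 1" using \<open>0 < c\<close> by simp
  finally show ?thesis by simp
qed

text \<open>The mass near \<open>0\<close> is tamed by \<open>r powr q\<close> with \<open>q > p\<close>, the tail has mass \<open>1 / p\<close>.\<close>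

lemma levy_measure_min_finite:
  assumes "0 < p" and "p < q"
  shows "(\<integral>\<^sup>+r. ennreal (min 1 (r powr q)) \<partial>levy_measure p) < \<infinity>"
proof -
  have near: "(\<integral>\<^sup>+r. ennreal (indicator {0..1} r * r powr (q - 1 - p)) \<partial>lborel) < \<infinity>"
    using assms nn_integral_has_integral_lebesgue[OF _ has_integral_powr_from_0[of "q - 1 - p" 1]]
    by auto
  have far: "(\<integral>\<^sup>+r. ennreal (indicator {1..} r * r powr (- 1 - p)) \<partial>lborel) < \<infinity>"
    using assms nn_integral_has_integral_lebesgue[OF _ has_integral_powr_to_inf[of "- 1 - p" 1]]
    by auto
  have "(\<integral>\<^sup>+r. ennreal (min 1 (r powr q)) \<partial>levy_measure p)
      = (\<integral>\<^sup>+r. ennreal (r powr (- 1 - p)) * indicator {0<..} r * ennreal (min 1 (r powr q)) \<partial>lborel)"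
    by (rule nn_integral_levy_measure) simp
  also have "\<dots> \<le> (\<integral>\<^sup>+r. (ennreal (indicator {0..1} r * r powr (q - 1 - p)))
      + ennreal (indicator {1..} r * r powr (- 1 - p)) \<partial>lborel)"
  proof (rule nn_integral_mono)
    fix r :: real
    have 1: "r powr (- 1 - p) * min 1 (r powr q) \<le> r powr (q - 1 - p)" if "0 < r"
    proof -
      have "r powr (- 1 - p) * min 1 (r powr q) \<le> r powr (- 1 - p) * r powr q"
        by (intro mult_left_mono) auto
      also have "\<dots> = r powr (q - 1 - p)" by (simp add: powr_add[symmetric] algebra_simps)
      finally show ?thesis .
    qed
    have 2: "r powr (- 1 - p) * min 1 (r powr q) \<le> r powr (- 1 - p)"
      by (rule mult_left_le) auto
    show "ennreal (r powr (- 1 - p)) * indicator {0<..} r * ennreal (min 1 (r powr q))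
        \<le> ennreal (indicator {0..1} r * r powr (q - 1 - p)) + ennreal (indicator {1..} r * r powr (- 1 - p))"
      using 1 2 by (cases "r \<le> 0"; cases "r < 1") (auto simp: indicator_def ennreal_mult[symmetric] add_increasing intro!: ennreal_leI)
  qed
  also have "\<dots> = (\<integral>\<^sup>+r. ennreal (indicator {0..1} r * r powr (q - 1 - p)) \<partial>lborel)
      + (\<integral>\<^sup>+r. ennreal (indicator {1..} r * r powr (- 1 - p)) \<partial>lborel)"
    by (rule nn_integral_add) auto
  also have "\<dots> < \<infinity>" using near far by simp
  finally show ?thesis .
qed

lemma integrable_levy_measure:
  assumes "0 < p" and "p < q" and [measurable]: "h \<in> borel_measurable borel"
    and bound: "\<And>r. 0 < r \<Longrightarrow> \<bar>h r\<bar> \<le> C * min 1 (r powr q)"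
  shows "integrable (levy_measure p) (h :: real \<Rightarrow> real)"
proof (rule Bochner_Integration.integrable_bound)
  have "integrable (levy_measure p) (\<lambda>r. min 1 (r powr q))"
    using levy_measure_min_finite[OF assms(1,2)] by (intro integrableI_bounded) auto
  then show "integrable (levy_measure p) (\<lambda>r. C * min 1 (r powr q))" by simp
  show "AE r in levy_measure p. norm (h r) \<le> norm (C * min 1 (r powr q))"
    using AE_levy_measure_pos[of p] by eventually_elim (use bound in \<open>auto intro: order_trans[OF _ abs_ge_self]\<close>)
qed simp

lemma levy_integral_scale:
  assumes [measurable]: "h \<in> borel_measurable borel" and "\<And>r. 0 \<le> h r" and "0 < c"
  shows "(LINT r|levy_measure p. h (c * r)) = c powr p * (LINT r|levy_measure p. h r)"
proof -
  have "(\<integral>\<^sup>+r. ennreal (h (c * r)) \<partial>levy_measure p) = ennreal (c powr p) * (\<integral>\<^sup>+r. ennreal (h r) \<partial>levy_measure p)"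
    by (rule levy_measure_scale[of "\<lambda>r. ennreal (h r)"]) (use \<open>0 < c\<close> in auto)
  then show ?thesis
    using assms(2) by (simp add: integral_eq_nn_integral enn2real_mult)
qed

lemma levy_integral_pos:
  fixes h :: "real \<Rightarrow> real"
  assumes int: "integrable (levy_measure p) h" and [measurable]: "h \<in> borel_measurable borel"
    and nonneg: "\<And>r. 0 \<le> h r" and pos: "\<And>r. 0 < r \<Longrightarrow> r < 1 \<Longrightarrow> 0 < h r"
  shows "0 < (LINT r|levy_measure p. h r)"
proof -
  have "(LINT r|levy_measure p. h r) \<noteq> 0"
  proof
    assume "(LINT r|levy_measure p. h r) = 0"
    then have "AE r in levy_measure p. h r = 0"
      using integral_nonneg_eq_0_iff_AE[OF int] nonneg by simp
    then have "AE r in lborel. 0 < r \<longrightarrow> h r = 0"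
      unfolding levy_measure_def by (subst (asm) AE_density) (auto simp: indicator_def ennreal_zero_less_mult_iff elim!: eventually_mono split: if_splits)
    then have "AE r in lborel. r \<notin> {0<..<1::real}"
      by eventually_elim (use pos in force)
    then have "emeasure lborel {0<..<1::real} = 0"
      by (subst (asm) AE_iff_measurable[where N = "{0<..<1}"]) auto
    then show False by simp
  qed
  moreover have "0 \<le> (LINT r|levy_measure p. h r)" using nonneg by (simp add: integral_nonneg)
  ultimately show ?thesis by simp
qed

lemma one_minus_exp_le_min: "0 \<le> r \<Longrightarrow> 1 - exp (- r) \<le> min 1 (r :: real)"
  using exp_ge_add_one_self[of "- r"] by simp

section \<open>Existence of positive stable laws\<close>

lemma integrable_levy_laplace:
  assumes "0 < p" and "p < 1" and "0 \<le> c"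
  shows "integrable (levy_measure p) (\<lambda>r. 1 - exp (- c * \<bar>r\<bar>))"
proof (rule integrable_levy_measure[OF assms(1,2)])
  fix r :: real assume "0 < r"
  have "1 - exp (- c * \<bar>r\<bar>) \<le> min 1 (c * r)"
    using one_minus_exp_le_min[of "c * r"] \<open>0 < r\<close> \<open>0 \<le> c\<close> by simp
  also have "\<dots> \<le> max 1 c * min 1 r"
  proof (cases "r \<le> 1")
    case True
    then have "c * r \<le> max 1 c * r" using \<open>0 < r\<close> by (intro mult_right_mono) auto
    then show ?thesis using True by simp
  next
    case False
    then show ?thesis by simp
  qed
  finally show "\<bar>1 - exp (- c * \<bar>r\<bar>)\<bar> \<le> max 1 c * min 1 (r powr 1)"
    using \<open>0 < r\<close> \<open>0 \<le> c\<close> by simp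
qed simp

text \<open>The Laplace exponent of the positive stable law, up to a constant.\<close>

lemma levy_laplace:
  assumes "0 < p" and "0 \<le> c"
  shows "(LINT r|levy_measure p. 1 - exp (- c * \<bar>r\<bar>))
      = c powr p * (LINT r|levy_measure p. 1 - exp (- \<bar>r\<bar>))"
proof (cases "c = 0")
  case False
  then have "0 < c" using assms(2) by simp
  have "(LINT r|levy_measure p. (\<lambda>r. 1 - exp (- \<bar>r\<bar>)) (c * r))
      = c powr p * (LINT r|levy_measure p. 1 - exp (- \<bar>r\<bar>))"
    by (rule levy_integral_scale) (use \<open>0 < c\<close> in auto)
  then show ?thesis using \<open>0 < c\<close> by (simp add: abs_mult)
qed (use assms in simp)

text \<open>Normalised sums of \<open>n + 1\<close> independent variables whose density is the power law of the Levy
  measure, damped near \<open>0\<close> by \<open>min 1 r\<close> to have finite mass. With the normalisation \<open>m\<close> chosen so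
  that the mass matches, rescaling moves the damping into \<open>min 1 (m * r)\<close>, which increases to \<open>1\<close>;
  so the summands have Laplace transform \<open>1 - a n c / (n + 1)\<close> with \<open>a n c\<close> below and converging
  to \<open>c powr p\<close>. Absolute values make every Laplace transform here an integral of a bounded
  continuous function on the whole line.\<close>

lemma positive_stable_array:
  assumes p: "0 < p" "p < 1"
  obtains Q :: "nat \<Rightarrow> real measure" and a :: "nat \<Rightarrow> real \<Rightarrow> real" where
    "\<And>n. real_distribution (Q n)"
    and "\<And>n c. 0 \<le> c \<Longrightarrow> (LINT s|Q n. exp (- c * \<bar>s\<bar>)) = (1 - a n c / real (Suc n)) ^ Suc n"
    and "\<And>n c. 0 \<le> c \<Longrightarrow> 0 \<le> a n c / real (Suc n) \<and> a n c / real (Suc n) \<le> 1 \<and> a n c \<le> c powr p"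
    and "\<And>c. 0 \<le> c \<Longrightarrow> (\<lambda>n. a n c) \<longlonglongrightarrow> c powr p"
proof -
  define K where "K = (LINT r|levy_measure p. 1 - exp (- \<bar>r\<bar>))"
  define Z where "Z = (LINT r|levy_measure p. min 1 \<bar>r\<bar>)"
  have int_exp: "integrable (levy_measure p) (\<lambda>r. 1 - exp (- c * \<bar>r\<bar>))" if "0 \<le> c" for c
    by (rule integrable_levy_laplace[OF p that])
  have int_min: "integrable (levy_measure p) (\<lambda>r. min 1 \<bar>r\<bar>)"
    by (rule integrable_levy_measure[OF p, of _ 1]) auto
  have "0 < K" unfolding K_def
    by (rule levy_integral_pos) (use int_exp[of 1] in auto)
  have "0 < Z" unfolding Z_def
    by (rule levy_integral_pos) (use int_min in auto)
  define \<rho> where "\<rho> = density (levy_measure p) (\<lambda>r. ennreal (min 1 \<bar>r\<bar> / Z))"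
  have int_\<rho>: "(LINT r|\<rho>. h r) = (LINT r|levy_measure p. min 1 \<bar>r\<bar> / Z * h r)"
    if [measurable]: "h \<in> borel_measurable borel" for h :: "real \<Rightarrow> real"
    unfolding \<rho>_def using \<open>0 < Z\<close> by (subst integral_density) auto
  have sets_\<rho> [measurable_cong, simp]: "sets \<rho> = sets borel" by (simp add: \<rho>_def)
  interpret \<rho>: prob_space \<rho>
  proof
    have "emeasure \<rho> (space \<rho>) = (\<integral>\<^sup>+r. ennreal (min 1 \<bar>r\<bar> / Z) \<partial>levy_measure p)"
      unfolding \<rho>_def by (subst emeasure_density) auto
    also have "\<dots> = ennreal (LINT r|levy_measure p. min 1 \<bar>r\<bar> / Z)"
      using int_min \<open>0 < Z\<close> by (intro nn_integral_eq_integral) auto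
    also have "\<dots> = 1" using \<open>0 < Z\<close> by (simp flip: Z_def)
    finally show "emeasure \<rho> (space \<rho>) = 1" .
  qed
  \<comment> \<open>The choice for which \<open>real (Suc n) * (1 / m n) powr p / Z = 1 / K\<close>.\<close>
  define m where "m n = (real (Suc n) * K / Z) powr (1 / p)" for n
  have m_pos: "0 < m n" for n using \<open>0 < K\<close> \<open>0 < Z\<close> by (simp add: m_def)
  have m_powr: "m n powr p = real (Suc n) * K / Z" for n
    using \<open>0 < K\<close> \<open>0 < Z\<close> p by (simp add: m_def powr_powr)
  have m_lim: "filterlim m at_top sequentially"
  proof -
    have "filterlim (\<lambda>n. (real (Suc n) * (K / Z)) powr (1 / p)) at_top sequentially"
      using \<open>0 < K\<close> \<open>0 < Z\<close> p by real_asymp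
    then show ?thesis by (simp add: m_def[abs_def])
  qed
  define b where "b n c = (LINT r|\<rho>. 1 - exp (- (c / m n) * \<bar>r\<bar>))" for n c
  define a where "a n c = real (Suc n) * b n c" for n c
  have b_bounds: "0 \<le> b n c" "b n c \<le> 1" if "0 \<le> c" for n c
  proof -
    have "integrable \<rho> (\<lambda>r. 1 - exp (- (c / m n) * \<bar>r\<bar>))"
      using that m_pos[of n] by (intro \<rho>.integrable_const_bound[of _ 1]) auto
    moreover have "0 \<le> 1 - exp (- (c / m n) * \<bar>r\<bar>)" for r
      using that m_pos[of n] by simp
    ultimately show "0 \<le> b n c" "b n c \<le> 1"
      unfolding b_def by (auto intro!: integral_nonneg \<rho>.integral_le_const)
  qed
  have a_eq: "a n c = (LINT r|levy_measure p. (1 - exp (- c * \<bar>r\<bar>)) * min 1 (m n * \<bar>r\<bar>)) / K"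
    if "0 \<le> c" for n c
  proof -
    let ?h = "\<lambda>r. (1 - exp (- c * \<bar>r\<bar>)) * min 1 (m n * \<bar>r\<bar>)"
    have "b n c = (LINT r|levy_measure p. ?h ((1 / m n) * r)) / Z"
      unfolding b_def using m_pos[of n] by (subst int_\<rho>) (auto simp: abs_mult mult.commute)
    also have "(LINT r|levy_measure p. ?h ((1 / m n) * r)) = (1 / m n) powr p * (LINT r|levy_measure p. ?h r)"
      by (rule levy_integral_scale) (use m_pos[of n] that in auto)
    also have "(1 / m n) powr p = Z / (real (Suc n) * K)"
      using m_pos[of n] by (simp add: powr_divide m_powr)
    finally show ?thesis using \<open>0 < Z\<close> by (simp add: a_def field_simps del: of_nat_Suc)
  qed
  have a_le: "a n c \<le> c powr p" if "0 \<le> c" for n c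
  proof -
    have "(LINT r|levy_measure p. (1 - exp (- c * \<bar>r\<bar>)) * min 1 (m n * \<bar>r\<bar>))
        \<le> (LINT r|levy_measure p. 1 - exp (- c * \<bar>r\<bar>))"
      using that m_pos[of n] int_exp[OF that] by (intro integral_mono') (auto intro!: mult_left_le)
    also have "\<dots> = c powr p * K" unfolding K_def using p that by (intro levy_laplace) auto
    finally show ?thesis unfolding a_eq[OF that] using \<open>0 < K\<close> by (simp add: divide_le_eq)
  qed
  have a_lim: "(\<lambda>n. a n c) \<longlonglongrightarrow> c powr p" if "0 \<le> c" for c
  proof -
    have "(\<lambda>n. LINT r|levy_measure p. (1 - exp (- c * \<bar>r\<bar>)) * min 1 (m n * \<bar>r\<bar>))
        \<longlonglongrightarrow> (LINT r|levy_measure p. 1 - exp (- c * \<bar>r\<bar>))"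
    proof (rule integral_dominated_convergence[where w = "\<lambda>r. 1 - exp (- c * \<bar>r\<bar>)"])
      show "AE r in levy_measure p. (\<lambda>n. (1 - exp (- c * \<bar>r\<bar>)) * min 1 (m n * \<bar>r\<bar>)) \<longlonglongrightarrow> 1 - exp (- c * \<bar>r\<bar>)"
        using AE_levy_measure_pos
      proof eventually_elim
        case (elim r)
        have "\<forall>\<^sub>F n in sequentially. m n \<ge> 1 / r" using m_lim by (simp add: filterlim_at_top)
        then have "\<forall>\<^sub>F n in sequentially. (1 - exp (- c * \<bar>r\<bar>)) * min 1 (m n * \<bar>r\<bar>) = 1 - exp (- c * \<bar>r\<bar>)"
          by eventually_elim (use elim in \<open>simp add: field_simps\<close>)
        then show ?case by (rule tendsto_eventually)
      qed
      show "AE r in levy_measure p. norm ((1 - exp (- c * \<bar>r\<bar>)) * min 1 (m n * \<bar>r\<bar>)) \<le> 1 - exp (- c * \<bar>r\<bar>)" for n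
        using that m_pos[of n] by (auto simp: abs_mult intro!: mult_left_le)
    qed (use int_exp[OF that] in auto)
    then have "(\<lambda>n. a n c) \<longlonglongrightarrow> (LINT r|levy_measure p. 1 - exp (- c * \<bar>r\<bar>)) / K"
      unfolding a_eq[OF that] using \<open>0 < K\<close> by (intro tendsto_divide) auto
    also have "(LINT r|levy_measure p. 1 - exp (- c * \<bar>r\<bar>)) / K = c powr p"
      using levy_laplace[of p c] p that \<open>0 < K\<close> by (simp flip: K_def)
    finally show ?thesis .
  qed
  define Q where "Q n = distr (\<Pi>\<^sub>M i\<in>{..<Suc n}. \<rho>) borel (\<lambda>x. (\<Sum>i<Suc n. \<bar>x i\<bar>) / m n)" for n
  interpret P: product_prob_space "\<lambda>_ :: nat. \<rho>" UNIV ..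
  have meas: "(\<lambda>x. (\<Sum>i<Suc n. \<bar>x i\<bar>) / m n) \<in> borel_measurable (\<Pi>\<^sub>M i\<in>{..<Suc n}. \<rho>)" for n
    by (intro borel_measurable_divide borel_measurable_sum borel_measurable_abs) auto
  have Q: "real_distribution (Q n)" for n
  proof -
    interpret prob_space "\<Pi>\<^sub>M i\<in>{..<Suc n}. \<rho>" by (intro prob_space_PiM \<rho>.prob_space_axioms)
    show ?thesis unfolding Q_def real_distribution_def real_distribution_axioms_def
      using prob_space_distr[OF meas[of n]] by (simp del: sum.lessThan_Suc)
  qed
  have Q_laplace: "(LINT s|Q n. exp (- c * \<bar>s\<bar>)) = (1 - a n c / real (Suc n)) ^ Suc n" if "0 \<le> c" for n c
  proof -
    have int: "integrable \<rho> (\<lambda>r. exp (- (c / m n) * \<bar>r\<bar>))"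
      using that m_pos[of n] by (intro \<rho>.integrable_const_bound[of _ 1]) auto
    have "(LINT s|Q n. exp (- c * \<bar>s\<bar>))
        = (LINT x|(\<Pi>\<^sub>M i\<in>{..<Suc n}. \<rho>). exp (- c * \<bar>(\<Sum>i<Suc n. \<bar>x i\<bar>) / m n\<bar>))"
      unfolding Q_def by (rule integral_distr[OF meas]) simp
    also have "\<dots> = (LINT x|(\<Pi>\<^sub>M i\<in>{..<Suc n}. \<rho>). (\<Prod>i<Suc n. exp (- (c / m n) * \<bar>x i\<bar>)))"
    proof (rule Bochner_Integration.integral_cong[OF refl])
      fix x :: "nat \<Rightarrow> real"
      have "\<bar>(\<Sum>i<Suc n. \<bar>x i\<bar>) / m n\<bar> = (\<Sum>i<Suc n. \<bar>x i\<bar>) / m n"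
        using m_pos[of n] by (intro abs_of_nonneg divide_nonneg_pos sum_nonneg) auto
      then have "exp (- c * \<bar>(\<Sum>i<Suc n. \<bar>x i\<bar>) / m n\<bar>) = exp (- (c / m n) * (\<Sum>i<Suc n. \<bar>x i\<bar>))"
        by (simp del: sum.lessThan_Suc)
      also have "\<dots> = (\<Prod>i<Suc n. exp (- (c / m n) * \<bar>x i\<bar>))"
        unfolding sum_distrib_left by (rule exp_sum) simp
      finally show "exp (- c * \<bar>(\<Sum>i<Suc n. \<bar>x i\<bar>) / m n\<bar>) = (\<Prod>i<Suc n. exp (- (c / m n) * \<bar>x i\<bar>))" .
    qed
    also have "\<dots> = (\<Prod>i<Suc n. LINT r|\<rho>. exp (- (c / m n) * \<bar>r\<bar>))"
      by (rule P.product_integral_prod) (use int in auto)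
    also have "\<dots> = (1 - b n c) ^ Suc n"
      using int by (simp add: b_def \<rho>.prob_space)
    finally show ?thesis by (simp add: a_def del: of_nat_Suc)
  qed
  show ?thesis
  proof (rule that[of Q a])
    show "0 \<le> a n c / real (Suc n) \<and> a n c / real (Suc n) \<le> 1 \<and> a n c \<le> c powr p" if "0 \<le> c" for n c
      using b_bounds[OF that, of n] a_le[OF that, of n] by (simp add: a_def del: of_nat_Suc)
  qed (use Q Q_laplace a_lim in auto)
qed

text \<open>The Laplace transforms of the normalised sums converge, and their bound \<open>1 - c powr p\<close> from
  below, uniform in \<open>n\<close>, gives tightness by a Markov inequality; any limit point given by Helly's
  selection theorem has the limiting Laplace transform. For \<open>p = 1\<close> the law is a point mass.\<close>

lemma positive_stable_exists:
  assumes "0 < p" and "p \<le> 1"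
  obtains Q :: "real measure" where "real_distribution Q"
    and "\<And>c. 0 \<le> c \<Longrightarrow> (LINT s|Q. exp (- c * \<bar>s\<bar>)) = exp (- (c powr p))"
proof (cases "p = 1")
  case True
  have "real_distribution (return borel (1::real))"
    by (simp add: real_distribution_def real_distribution_axioms_def prob_space_return)
  moreover have "(LINT s|return borel (1::real). exp (- c * \<bar>s\<bar>)) = exp (- (c powr p))" if "0 \<le> c" for c
    using that True by (simp add: integral_return)
  ultimately show ?thesis by (rule that)
next
  case False
  then have p: "0 < p" "p < 1" using assms by auto
  obtain Q :: "nat \<Rightarrow> real measure" and a where
    Q: "\<And>n. real_distribution (Q n)"
    and laplace: "\<And>n c. 0 \<le> c \<Longrightarrow> (LINT s|Q n. exp (- c * \<bar>s\<bar>)) = (1 - a n c / real (Suc n)) ^ Suc n"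
    and a: "\<And>n c. 0 \<le> c \<Longrightarrow> 0 \<le> a n c / real (Suc n) \<and> a n c / real (Suc n) \<le> 1 \<and> a n c \<le> c powr p"
    and a_lim: "\<And>c. 0 \<le> c \<Longrightarrow> (\<lambda>n. a n c) \<longlonglongrightarrow> c powr p"
    using positive_stable_array[OF p] by blast
  have laplace_ge: "1 - c powr p \<le> (LINT s|Q n. exp (- c * \<bar>s\<bar>))" if "0 \<le> c" for c n
  proof -
    have "1 - c powr p \<le> 1 + real (Suc n) * (- (a n c / real (Suc n)))" using a[OF that, of n] by simp
    also have "\<dots> \<le> (1 + - (a n c / real (Suc n))) ^ Suc n"
      using a[OF that, of n] by (intro Bernoulli_inequality) auto
    finally show ?thesis unfolding laplace[OF that] by simp
  qed
  have laplace_lim: "(\<lambda>n. LINT s|Q n. exp (- c * \<bar>s\<bar>)) \<longlonglongrightarrow> exp (- (c powr p))" if "0 \<le> c" for c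
  proof -
    obtain N :: nat where N: "c powr p < real N" using reals_Archimedean2 by blast
    have "norm ((1 - a n c / real (Suc n)) ^ Suc n - (1 - c powr p / real (Suc n)) ^ Suc n)
        \<le> c powr p - a n c" if "n \<ge> N" for n
    proof -
      have "c powr p / real (Suc n) \<le> 1" using N that by simp
      then have "norm ((1 - a n c / real (Suc n)) ^ Suc n - (1 - c powr p / real (Suc n)) ^ Suc n)
          \<le> real (Suc n) * norm ((1 - a n c / real (Suc n)) - (1 - c powr p / real (Suc n)))"
        using a[OF \<open>0 \<le> c\<close>, of n] by (intro norm_power_diff) auto
      also have "(1 - a n c / real (Suc n)) - (1 - c powr p / real (Suc n)) = (c powr p - a n c) / real (Suc n)"
        by (simp add: diff_divide_distrib)
      also have "real (Suc n) * norm ((c powr p - a n c) / real (Suc n)) = c powr p - a n c"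
        using a[OF \<open>0 \<le> c\<close>, of n] by (simp add: norm_divide del: of_nat_Suc)
      finally show ?thesis .
    qed
    moreover have "(\<lambda>n. c powr p - a n c) \<longlonglongrightarrow> 0"
      using tendsto_diff[OF tendsto_const a_lim[OF that], of "c powr p"] by simp
    ultimately have "(\<lambda>n. (1 - a n c / real (Suc n)) ^ Suc n - (1 - c powr p / real (Suc n)) ^ Suc n) \<longlonglongrightarrow> 0"
      by (rule Lim_null_comparison[OF eventually_sequentiallyI[of N]])
    moreover have "(\<lambda>n. (1 - c powr p / real (Suc n)) ^ Suc n) \<longlonglongrightarrow> exp (- (c powr p))"
      using LIMSEQ_Suc[OF tendsto_exp_limit_sequentially[of "- (c powr p)"]] by (simp del: of_nat_Suc power_Suc)
    ultimately have "(\<lambda>n. (1 - a n c / real (Suc n)) ^ Suc n) \<longlonglongrightarrow> exp (- (c powr p))"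
      by (rule Lim_transform[rotated])
    then show ?thesis unfolding laplace[OF that] .
  qed
  have "tight Q"
    unfolding tight_def
  proof (intro conjI allI impI Q)
    fix \<epsilon> :: real assume "0 < \<epsilon>"
    define R where "R = (4 / \<epsilon>) powr (1 / p)"
    have "0 < R" using \<open>0 < \<epsilon>\<close> by (simp add: R_def)
    have R_powr: "(1 / R) powr p = \<epsilon> / 4"
      using \<open>0 < \<epsilon>\<close> p by (simp add: R_def powr_divide powr_powr)
    have "measure (Q n) {-(R + 1)<..R + 1} > 1 - \<epsilon>" for n
    proof -
      interpret Q: real_distribution "Q n" by (rule Q)
      have int: "integrable (Q n) (\<lambda>s. exp (- (1 / R) * \<bar>s\<bar>))"
        using \<open>0 < R\<close> by (intro Q.integrable_const_bound[of _ 1]) auto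
      \<comment> \<open>Markov's inequality for \<open>1 - exp (- \<bar>s\<bar> / R)\<close>, which is at least 1/2 where \<open>\<bar>s\<bar> > R\<close>.\<close>
      have "1 - exp (- (1 / R) * \<bar>s\<bar>) \<ge> indicator (- {-(R + 1)<..R + 1}) s / 2" for s
      proof (cases "\<bar>s\<bar> \<le> R")
        case True
        then show ?thesis using \<open>0 < R\<close> by (auto simp: indicator_def)
      next
        case False
        have "2 \<le> exp (1 :: real)" using exp_ge_add_one_self[of 1] by simp
        also have "\<dots> \<le> exp ((1 / R) * \<bar>s\<bar>)" using False \<open>0 < R\<close> by (simp add: field_simps)
        finally have "exp (- (1 / R) * \<bar>s\<bar>) \<le> 1 / 2"
          by (simp add: exp_minus field_simps)
        then show ?thesis using \<open>0 < R\<close> by (auto simp: indicator_def)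
      qed
      then have "(LINT s|Q n. indicator (- {-(R + 1)<..R + 1}) s / 2) \<le> (LINT s|Q n. 1 - exp (- (1 / R) * \<bar>s\<bar>))"
        using int
        by (intro integral_mono Q.integrable_const_bound[of "\<lambda>s. indicator (- {-(R + 1)<..R + 1}) s / 2" 1])
          (auto simp: indicator_def)
      also have "\<dots> = 1 - (LINT s|Q n. exp (- (1 / R) * \<bar>s\<bar>))"
        using int Q.prob_space by simp
      also have "\<dots> \<le> \<epsilon> / 4" using laplace_ge[of "1 / R" n] \<open>0 < R\<close> R_powr by simp
      finally have "measure (Q n) (- {-(R + 1)<..R + 1}) \<le> \<epsilon> / 2" by simp
      moreover have "measure (Q n) (- {-(R + 1)<..R + 1}) = 1 - measure (Q n) {-(R + 1)<..R + 1}"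
        using Q.prob_compl[of "{-(R + 1)<..R + 1}"] by (simp add: Compl_eq_Diff_UNIV)
      ultimately show ?thesis using \<open>0 < \<epsilon>\<close> by simp
    qed
    then show "\<exists>a b. a < b \<and> (\<forall>n. 1 - \<epsilon> < measure (Q n) {a<..b})"
      using \<open>0 < R\<close> by (intro exI[of _ "-(R + 1)"] exI[of _ "R + 1"]) auto
  qed
  then obtain r M where r: "strict_mono (r :: nat \<Rightarrow> nat)" and M: "real_distribution M"
    and conv: "weak_conv_m (Q \<circ> id \<circ> r) M"
    using tight_imp_convergent_subsubsequence[of Q id] strict_mono_id by blast
  have "(LINT s|M. exp (- c * \<bar>s\<bar>)) = exp (- (c powr p))" if "0 \<le> c" for c
  proof (rule LIMSEQ_unique)
    show "(\<lambda>n. LINT s|(Q \<circ> id \<circ> r) n. exp (- c * \<bar>s\<bar>)) \<longlonglongrightarrow> (LINT s|M. exp (- c * \<bar>s\<bar>))"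
      using Q M that
      by (intro weak_conv_imp_integral_bdd_continuous_conv[OF _ _ conv, of _ 1])
        (auto intro!: continuous_intros)
    show "(\<lambda>n. LINT s|(Q \<circ> id \<circ> r) n. exp (- c * \<bar>s\<bar>)) \<longlonglongrightarrow> exp (- (c powr p))"
      using LIMSEQ_subseq_LIMSEQ[OF laplace_lim[OF that] r] by (simp add: o_def)
  qed
  with M show ?thesis by (rule that)
qed

section \<open>Existence of sub-Gaussian laws\<close>

lemma borel_measurable_vec:
  fixes f :: "'a \<Rightarrow> real ^ 'd"
  assumes "\<And>i. (\<lambda>x. f x $ i) \<in> borel_measurable M"
  shows "f \<in> borel_measurable M"
  by (subst borel_measurable_euclidean_space) (use assms in \<open>auto simp: Basis_vec_def inner_axis\<close>)

text \<open>For \<open>Q\<close> positive \<open>\<alpha> / 2\<close>-stable and \<open>Z\<close> standard Gaussian, independent of it, the vector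
  \<open>sqrt (2 * Q) *\<^sub>R Z\<close> has, given \<open>Q\<close>, the characteristic function \<open>exp (- Q * (norm u)\<^sup>2)\<close>. Averaging
  over \<open>Q\<close> produces its Laplace transform at \<open>(norm u)\<^sup>2\<close>.\<close>

lemma isotropic_stable_exists:
  assumes "0 < \<alpha>" and "\<alpha> \<le> 2"
  obtains \<mu> :: "(real ^ 'd) measure" where "prob_law \<mu>"
    and "\<And>u. char_fun \<mu> u = complex_of_real (exp (- (norm u powr \<alpha>)))"
proof -
  obtain Q :: "real measure" where Q: "real_distribution Q"
    and laplace: "\<And>c. 0 \<le> c \<Longrightarrow> (LINT s|Q. exp (- c * \<bar>s\<bar>)) = exp (- (c powr (\<alpha> / 2)))"
    using positive_stable_exists[of "\<alpha> / 2"] assms by auto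
  interpret Q: real_distribution Q by (rule Q)
  define G where "G = (\<Pi>\<^sub>M i\<in>(UNIV :: 'd set). std_normal_distribution)"
  interpret N: real_distribution std_normal_distribution by (rule real_dist_normal_dist)
  have int_iexp: "complex_integrable std_normal_distribution (\<lambda>x. iexp (c * x))" for c
    by (rule N.integrable_const_bound[of _ 1]) auto
  interpret N: product_prob_space "\<lambda>_ :: 'd. std_normal_distribution" UNIV ..
  interpret G: prob_space G unfolding G_def by (intro prob_space_PiM N.prob_space_axioms)
  interpret QG: pair_prob_space Q G ..
  define X :: "real \<times> ('d \<Rightarrow> real) \<Rightarrow> real ^ 'd"
    where "X = (\<lambda>(s, z). \<chi> i. sqrt (2 * \<bar>s\<bar>) * z i)"
  define \<mu> :: "(real ^ 'd) measure" where "\<mu> = distr (Q \<Otimes>\<^sub>M G) borel X"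
  have coord [measurable]: "(\<lambda>z. z i) \<in> borel_measurable G" for i :: 'd
    unfolding G_def by (rule measurable_compose[OF measurable_component_singleton]) auto
  have X [measurable]: "X \<in> borel_measurable (Q \<Otimes>\<^sub>M G)"
    unfolding X_def split_beta'
    by (rule borel_measurable_vec) simp
  have \<mu>: "prob_law \<mu>"
    unfolding \<mu>_def prob_law_def by (simp add: QG.prob_space_distr)
  have "char_fun \<mu> u = complex_of_real (exp (- (norm u powr \<alpha>)))" for u
  proof -
    have "char_fun \<mu> u = (CLINT p|Q \<Otimes>\<^sub>M G. iexp (u \<bullet> X p))"
      unfolding char_fun_def \<mu>_def by (rule integral_distr) auto
    also have "\<dots> = (CLINT s|Q. CLINT z|G. iexp (u \<bullet> X (s, z)))"
      by (rule QG.integral_fst'[symmetric], rule QG.P.integrable_const_bound[of _ 1]) auto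
    also have "\<dots> = (CLINT s|Q. complex_of_real (exp (- (norm u)\<^sup>2 * \<bar>s\<bar>)))"
    proof (rule Bochner_Integration.integral_cong[OF refl])
      fix s :: real
      have "(CLINT z|G. iexp (u \<bullet> X (s, z)))
          = (CLINT z|G. (\<Prod>i\<in>UNIV. iexp (u $ i * sqrt (2 * \<bar>s\<bar>) * z i)))"
        by (simp add: X_def inner_vec_def exp_sum[symmetric] sum_distrib_left mult.assoc)
      also have "\<dots> = (\<Prod>i\<in>UNIV. CLINT x|std_normal_distribution. iexp (u $ i * sqrt (2 * \<bar>s\<bar>) * x))"
        unfolding G_def by (intro N.product_integral_prod int_iexp) simp
      also have "\<dots> = (\<Prod>i\<in>UNIV. complex_of_real (exp (- (u $ i)\<^sup>2 * \<bar>s\<bar>)))"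
        by (simp only: char_def[symmetric] char_std_normal_distribution)
          (simp add: power_mult_distrib)
      also have "\<dots> = complex_of_real (exp (- (norm u)\<^sup>2 * \<bar>s\<bar>))"
      proof -
        have "(norm u)\<^sup>2 = (\<Sum>i\<in>UNIV. (u $ i)\<^sup>2)"
          unfolding power2_norm_eq_inner inner_vec_def by (simp add: power2_eq_square)
        then show ?thesis
          by (simp add: exp_sum[symmetric] of_real_prod[symmetric] sum_negf sum_distrib_right
              del: of_real_prod)
      qed
      finally show "(CLINT z|G. iexp (u \<bullet> X (s, z))) = complex_of_real (exp (- (norm u)\<^sup>2 * \<bar>s\<bar>))" .
    qed
    also have "\<dots> = complex_of_real (LINT s|Q. exp (- (norm u)\<^sup>2 * \<bar>s\<bar>))"
      by (rule integral_complex_of_real)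
    also have "(LINT s|Q. exp (- (norm u)\<^sup>2 * \<bar>s\<bar>)) = exp (- (norm u powr \<alpha>))"
      by (subst laplace) (simp_all add: powr_powr flip: powr_numeral)
    finally show ?thesis .
  qed
  with \<mu> show ?thesis by (rule that)
qed

lemma char_fun_distr_adjoint:
  fixes B :: "real ^ 'd \<Rightarrow> real ^ 'e"
  assumes "prob_law \<mu>" and "linear B"
  shows "prob_law (distr \<mu> borel (adjoint B))"
    and "char_fun (distr \<mu> borel (adjoint B)) u = char_fun \<mu> (B u)"
proof -
  interpret prob_space \<mu> using assms(1) by (simp add: prob_law_def)
  have "adjoint B \<in> borel_measurable borel"
    using adjoint_linear[OF assms(2)] by (intro borel_measurable_continuous_onI linear_continuous_on linear_conv_bounded_linear[THEN iffD1])
  then have [measurable]: "adjoint B \<in> borel_measurable \<mu>"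
    by (rule measurable_prob_law[OF assms(1)])
  show "prob_law (distr \<mu> borel (adjoint B))" by (simp add: prob_law_def prob_space_distr)
  show "char_fun (distr \<mu> borel (adjoint B)) u = char_fun \<mu> (B u)"
    unfolding char_fun_def
    by (subst integral_distr) (auto simp: adjoint_works[OF assms(2)] inner_commute[of u] inner_commute[of "B u"])
qed

lemma minkowski_functional_ellipsoid:
  fixes A :: "real ^ 'd \<Rightarrow> real ^ 'd"
  assumes "linear A" and "bij A"
  shows "minkowski_functional (A ` cball 0 1) u = norm (inv A u)"
proof -
  have "u \<in> (\<lambda>x. s *\<^sub>R x) ` A ` cball 0 1 \<longleftrightarrow> norm (inv A u) \<le> s" if "0 \<le> s" for s
  proof
    assume "u \<in> (\<lambda>x. s *\<^sub>R x) ` A ` cball 0 1"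
    then obtain y where y: "norm y \<le> 1" "u = s *\<^sub>R A y" by auto
    have "inv A u = s *\<^sub>R y"
      unfolding y(2) linear_cmul[OF assms(1), symmetric]
      using bij_is_inj[OF assms(2)] by simp
    then show "norm (inv A u) \<le> s" using y(1) that by (simp add: mult_left_le)
  next
    assume le: "norm (inv A u) \<le> s"
    have u: "A (inv A u) = u" using bij_is_surj[OF assms(2)] by (simp add: surj_f_inv_f)
    show "u \<in> (\<lambda>x. s *\<^sub>R x) ` A ` cball 0 1"
    proof (cases "s = 0")
      case True
      then have "u = 0" using le u linear_0[OF assms(1)] by simp
      then have "u = s *\<^sub>R A 0" using linear_0[OF assms(1)] by simp
      moreover have "(0 :: real ^ 'd) \<in> cball 0 1" by simp
      ultimately show ?thesis by blast
    next
      case False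
      then have "0 < s" using that by simp
      have "u = s *\<^sub>R A ((1 / s) *\<^sub>R inv A u)"
        unfolding linear_cmul[OF assms(1)] u using \<open>0 < s\<close> by simp
      moreover have "(1 / s) *\<^sub>R inv A u \<in> cball 0 1" using le \<open>0 < s\<close> by simp
      ultimately show ?thesis by blast
    qed
  qed
  then have "{s. 0 \<le> s \<and> u \<in> (\<lambda>x. s *\<^sub>R x) ` A ` cball 0 1} = {norm (inv A u)..}"
    by (auto intro: order_trans[OF norm_ge_zero])
  then show ?thesis unfolding minkowski_functional_def by simp
qed

text \<open>The image of the isotropic law under the adjoint of \<open>B\<close>; the ellipsoid is the preimage of the
  unit ball under \<open>B\<close>.\<close>

lemma sub_Gaussian_exists:
  fixes B :: "real ^ 'd \<Rightarrow> real ^ 'd"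
  assumes "0 < \<alpha>" and "\<alpha> \<le> 2" and "linear B" and "inj B"
  obtains \<mu> where "sub_Gaussian \<alpha> \<mu>"
    and "\<And>u. char_fun \<mu> u = complex_of_real (exp (- (norm (B u) powr \<alpha>)))"
proof -
  obtain \<mu> :: "(real ^ 'd) measure" where \<mu>: "prob_law \<mu>"
    "\<And>u. char_fun \<mu> u = complex_of_real (exp (- (norm u powr \<alpha>)))"
    using isotropic_stable_exists[OF assms(1,2)] by blast
  define \<nu> where "\<nu> = distr \<mu> borel (adjoint B)"
  have \<nu>: "prob_law \<nu>" "char_fun \<nu> u = complex_of_real (exp (- (norm (B u) powr \<alpha>)))" for u
    unfolding \<nu>_def using char_fun_distr_adjoint[OF \<mu>(1) assms(3)] \<mu>(2) by auto
  have "surj B" using linear_injective_imp_surjective[OF assms(3,4)] by simp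
  then have "bij B" using assms(4) by (simp add: bij_def)
  have inv: "linear (inv B)" "bij (inv B)" "inv (inv B) = B"
    using assms \<open>surj B\<close> \<open>bij B\<close> by (auto simp: inj_linear_imp_inv_linear bij_imp_bij_inv inv_inv_eq)
  have "minkowski_functional (inv B ` cball 0 1) u = norm (B u)" for u
    using minkowski_functional_ellipsoid[OF inv(1,2)] inv(3) by simp
  then have "sub_Gaussian \<alpha> \<nu>"
    unfolding sub_Gaussian_def centred_ellipsoid_def using \<nu> inv(1,2) by metis
  then show ?thesis using \<nu>(2) by (rule that)
qed

lemma sub_Gaussian_char_fun:
  fixes \<mu> :: "(real ^ 'd) measure"
  assumes "sub_Gaussian \<alpha> \<mu>"
  obtains B :: "real ^ 'd \<Rightarrow> real ^ 'd" where "linear B" and "prob_law \<mu>"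
    and "\<And>u. char_fun \<mu> u = complex_of_real (exp (- (norm (B u) powr \<alpha>)))"
proof -
  obtain A :: "real ^ 'd \<Rightarrow> real ^ 'd" where A: "linear A" "bij A" and "prob_law \<mu>"
    and "\<And>u. char_fun \<mu> u = complex_of_real (exp (- (minkowski_functional (A ` cball 0 1) u powr \<alpha>)))"
    using assms unfolding sub_Gaussian_def centred_ellipsoid_def by blast
  then show ?thesis
    using that[of "inv A"] minkowski_functional_ellipsoid[OF A] inj_linear_imp_inv_linear[OF A(1) bij_is_inj[OF A(2)]]
    by simp
qed

section \<open>Sums of independent vectors\<close>

lemma char_fun_indep_sum_law:
  fixes \<mu> :: "nat \<Rightarrow> (real ^ 'd) measure"
  assumes "\<And>i. i < n \<Longrightarrow> prob_law (\<mu> i)"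
  shows "prob_law (indep_sum_law n \<mu>)"
    and "char_fun (indep_sum_law n \<mu>) u = (\<Prod>i<n. char_fun (\<mu> i) u)"
proof -
  \<comment> \<open>Outside \<open>{..<n}\<close> nothing is known about \<open>\<mu>\<close>; a product of probability spaces needs a law at every index.\<close>
  define \<mu>' where "\<mu>' i = (if i < n then \<mu> i else return borel 0)" for i
  have \<mu>': "prob_law (\<mu>' i)" for i
    using assms by (auto simp: \<mu>'_def prob_law_def prob_space_return)
  then have [measurable_cong]: "sets (\<mu>' i) = sets borel" for i by (simp add: prob_law_def)
  interpret product_prob_space \<mu>' UNIV
    using \<mu>' by (intro product_prob_spaceI) (simp add: prob_law_def)
  interpret S: prob_space "\<Pi>\<^sub>M i\<in>{..<n}. \<mu>' i"
    by (rule prob_space_PiM) (use \<mu>' in \<open>simp add: prob_law_def\<close>)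
  have eq: "indep_sum_law n \<mu> = distr (\<Pi>\<^sub>M i\<in>{..<n}. \<mu>' i) borel (\<lambda>x. \<Sum>i<n. x i)"
    unfolding indep_sum_law_def by (intro arg_cong3[where f = distr] PiM_cong) (auto simp: \<mu>'_def)
  have meas: "(\<lambda>x. \<Sum>i<n. x i) \<in> borel_measurable (\<Pi>\<^sub>M i\<in>{..<n}. \<mu>' i)"
    by (intro borel_measurable_sum) (auto intro!: measurable_compose[OF measurable_component_singleton])
  show "prob_law (indep_sum_law n \<mu>)"
    unfolding eq prob_law_def by (simp add: S.prob_space_distr[OF meas])
  have "char_fun (indep_sum_law n \<mu>) u = (CLINT x|(\<Pi>\<^sub>M i\<in>{..<n}. \<mu>' i). iexp (u \<bullet> (\<Sum>i<n. x i)))"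
    unfolding eq char_fun_def by (rule integral_distr[OF meas]) auto
  also have "\<dots> = (CLINT x|(\<Pi>\<^sub>M i\<in>{..<n}. \<mu>' i). (\<Prod>i<n. iexp (u \<bullet> x i)))"
    by (simp add: inner_sum_right exp_sum sum_distrib_left)
  also have "\<dots> = (\<Prod>i<n. CLINT x|\<mu>' i. iexp (u \<bullet> x))"
    by (intro product_integral_prod prob_law_integrable_iexp \<mu>') simp
  also have "\<dots> = (\<Prod>i<n. char_fun (\<mu> i) u)"
    by (intro prod.cong) (auto simp: char_fun_def \<mu>'_def)
  finally show "char_fun (indep_sum_law n \<mu>) u = (\<Prod>i<n. char_fun (\<mu> i) u)" .
qed

section \<open>Stability as a functional equation\<close>

lemma char_fun_distr:
  fixes T :: "real ^ 'd \<Rightarrow> real ^ 'd"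
  assumes "prob_law \<mu>" and "T \<in> borel_measurable borel"
  shows "char_fun (distr \<mu> borel T) u = (CLINT x|\<mu>. iexp (u \<bullet> T x))"
  unfolding char_fun_def by (rule integral_distr) (use measurable_prob_law[OF assms] in auto)

lemma char_fun_pair_sum:
  fixes \<mu> :: "(real ^ 'd) measure"
  assumes "prob_law \<mu>"
  shows "char_fun (distr (\<mu> \<Otimes>\<^sub>M \<mu>) borel (\<lambda>(x, y). a *\<^sub>R x + b *\<^sub>R y)) u
      = char_fun \<mu> (a *\<^sub>R u) * char_fun \<mu> (b *\<^sub>R u)"
    and "prob_law (distr (\<mu> \<Otimes>\<^sub>M \<mu>) borel (\<lambda>(x, y). a *\<^sub>R x + b *\<^sub>R y))"
proof -
  interpret M: prob_space \<mu> using assms by (simp add: prob_law_def)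
  interpret P: pair_prob_space \<mu> \<mu> ..
  have sets [measurable_cong]: "sets \<mu> = sets borel" using assms by (simp add: prob_law_def)
  have meas: "(\<lambda>(x, y). a *\<^sub>R x + b *\<^sub>R y) \<in> borel_measurable (\<mu> \<Otimes>\<^sub>M \<mu>)"
    unfolding split_beta' by measurable
  show "prob_law (distr (\<mu> \<Otimes>\<^sub>M \<mu>) borel (\<lambda>(x, y). a *\<^sub>R x + b *\<^sub>R y))"
    unfolding prob_law_def by (simp add: P.prob_space_distr[OF meas])
  have "char_fun (distr (\<mu> \<Otimes>\<^sub>M \<mu>) borel (\<lambda>(x, y). a *\<^sub>R x + b *\<^sub>R y)) u
      = (CLINT p|\<mu> \<Otimes>\<^sub>M \<mu>. iexp (u \<bullet> (case p of (x, y) \<Rightarrow> a *\<^sub>R x + b *\<^sub>R y)))"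
    unfolding char_fun_def by (rule integral_distr[OF meas]) auto
  also have "\<dots> = (CLINT p|\<mu> \<Otimes>\<^sub>M \<mu>. iexp ((a *\<^sub>R u) \<bullet> fst p) * iexp ((b *\<^sub>R u) \<bullet> snd p))"
    by (intro Bochner_Integration.integral_cong)
      (auto simp: inner_add_right distrib_left exp_add)
  also have "\<dots> = (CLINT x|\<mu>. CLINT y|\<mu>. iexp ((a *\<^sub>R u) \<bullet> x) * iexp ((b *\<^sub>R u) \<bullet> y))"
    by (subst P.integral_fst'[symmetric])
      (auto intro!: P.P.integrable_const_bound[of _ 1] simp: norm_mult)
  also have "\<dots> = char_fun \<mu> (a *\<^sub>R u) * char_fun \<mu> (b *\<^sub>R u)"
    by (simp add: char_fun_def)
  finally show "char_fun (distr (\<mu> \<Otimes>\<^sub>M \<mu>) borel (\<lambda>(x, y). a *\<^sub>R x + b *\<^sub>R y)) u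
      = char_fun \<mu> (a *\<^sub>R u) * char_fun \<mu> (b *\<^sub>R u)" .
qed

text \<open>Both conditions in the definition of a symmetric stable law compare two laws, so by uniqueness
  they are equations between characteristic functions. In this form they pass to limits.\<close>

lemma sym_stable_iff_char_fun:
  fixes \<mu> :: "(real ^ 'd) measure"
  assumes \<mu>: "prob_law \<mu>"
  shows "sym_stable \<alpha> \<mu> \<longleftrightarrow> (\<forall>u. char_fun \<mu> (- u) = char_fun \<mu> u) \<and>
    (\<forall>a>0. \<forall>b>0. \<forall>u. char_fun \<mu> (a powr (1 / \<alpha>) *\<^sub>R u) * char_fun \<mu> (b powr (1 / \<alpha>) *\<^sub>R u)
      = char_fun \<mu> ((a + b) powr (1 / \<alpha>) *\<^sub>R u))"
proof -
  interpret prob_space \<mu> using \<mu> by (simp add: prob_law_def)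
  have law: "prob_law (distr \<mu> borel T)" if "T \<in> borel_measurable borel" for T :: "real ^ 'd \<Rightarrow> real ^ 'd"
    using that by (simp add: prob_law_def prob_space_distr measurable_prob_law[OF \<mu>])
  have eq_iff: "\<mu>1 = \<mu>2 \<longleftrightarrow> (\<forall>u. char_fun \<mu>1 u = char_fun \<mu>2 u)"
    if "prob_law \<mu>1" "prob_law \<mu>2" for \<mu>1 \<mu>2 :: "(real ^ 'd) measure"
    using char_fun_unique[OF that] by auto
  have minus: "char_fun (distr \<mu> borel uminus) u = char_fun \<mu> (- u)" for u
    by (subst char_fun_distr[OF \<mu>]) (simp_all add: char_fun_def)
  have scale: "char_fun (distr \<mu> borel (\<lambda>x. c *\<^sub>R x)) u = char_fun \<mu> (c *\<^sub>R u)" for c u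
    by (subst char_fun_distr[OF \<mu>]) (simp_all add: char_fun_def)
  have 1: "distr \<mu> borel uminus = \<mu> \<longleftrightarrow> (\<forall>u. char_fun \<mu> (- u) = char_fun \<mu> u)"
    by (subst eq_iff) (simp_all add: law \<mu> minus)
  have 2: "distr (\<mu> \<Otimes>\<^sub>M \<mu>) borel (\<lambda>(x, y). a *\<^sub>R x + b *\<^sub>R y) = distr \<mu> borel (\<lambda>x. c *\<^sub>R x)
      \<longleftrightarrow> (\<forall>u. char_fun \<mu> (a *\<^sub>R u) * char_fun \<mu> (b *\<^sub>R u) = char_fun \<mu> (c *\<^sub>R u))" for a b c
    by (subst eq_iff) (simp_all add: law char_fun_pair_sum[OF \<mu>] scale)
  show ?thesis unfolding sym_stable_def 1 2 by simp
qed

text \<open>Cauchy's functional equation on the positive half-line. Nonnegativity forces monotonicity, and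
  comparing \<open>n * t\<close> with the integers next to it shows that \<open>n * \<bar>L t - t * L 1\<bar>\<close> stays bounded.\<close>

lemma additive_nonneg_linear:
  fixes L :: "real \<Rightarrow> real"
  assumes add: "\<And>s t. 0 < s \<Longrightarrow> 0 < t \<Longrightarrow> L (s + t) = L s + L t"
    and nonneg: "\<And>t. 0 < t \<Longrightarrow> 0 \<le> L t" and "0 < t"
  shows "L t = t * L 1"
proof -
  have mult: "L (real (Suc n) * s) = real (Suc n) * L s" if "0 < s" for n s
  proof (induction n)
    case (Suc n)
    have "L (real (Suc (Suc n)) * s) = L (real (Suc n) * s + s)" by (simp add: algebra_simps)
    also have "\<dots> = L (real (Suc n) * s) + L s" using that by (intro add) auto
    finally show ?case using Suc by (simp add: algebra_simps)
  qed simp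
  have mono: "L s \<le> L t" if "0 < s" "s \<le> t" for s t
    using add[of s "t - s"] nonneg[of "t - s"] that by (cases "s = t") auto
  have bound: "real (Suc n) * \<bar>L t - t * L 1\<bar> \<le> L 1" for n
  proof -
    define k where "k = nat \<lfloor>real (Suc n) * t\<rfloor>"
    have "0 < real (Suc n) * t" using \<open>0 < t\<close> by simp
    then have k: "real k \<le> real (Suc n) * t" "real (Suc n) * t < real (Suc k)"
      unfolding k_def by linarith+
    have "real (Suc n) * L t \<le> real (Suc k) * L 1"
      using mono[OF \<open>0 < real (Suc n) * t\<close> less_imp_le[OF k(2)]] mult[of t n] mult[of 1 k] \<open>0 < t\<close> by simp
    moreover have "real k * L 1 \<le> real (Suc n) * L t"
    proof (cases k)
      case 0
      then show ?thesis using nonneg[OF \<open>0 < t\<close>] by simp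
    next
      case (Suc j)
      then show ?thesis using mono[OF _ k(1)] mult[of t n] mult[of 1 j] \<open>0 < t\<close> by simp
    qed
    moreover have "real k * L 1 \<le> real (Suc n) * t * L 1" "real (Suc n) * t * L 1 \<le> real (Suc k) * L 1"
      using k nonneg[of 1] by (auto intro!: mult_right_mono simp del: of_nat_Suc)
    ultimately have "\<bar>real (Suc n) * L t - real (Suc n) * t * L 1\<bar> \<le> L 1"
      unfolding of_nat_Suc[of k] distrib_right abs_le_iff by linarith
    also have "real (Suc n) * L t - real (Suc n) * t * L 1 = real (Suc n) * (L t - t * L 1)"
      by (simp only: right_diff_distrib mult.assoc)
    finally show ?thesis by (simp add: abs_mult)
  qed
  show ?thesis
  proof (rule ccontr)
    assume "L t \<noteq> t * L 1"
    then obtain n where "L 1 < real n * \<bar>L t - t * L 1\<bar>"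
      using reals_Archimedean3[of "\<bar>L t - t * L 1\<bar>"] by auto
    also have "\<dots> \<le> real (Suc n) * \<bar>L t - t * L 1\<bar>" by (intro mult_right_mono) auto
    finally show False using bound[of n] by simp
  qed
qed

lemma norm_char_fun_le_1:
  assumes "prob_law \<mu>"
  shows "norm (char_fun \<mu> u) \<le> 1"
  using real_distribution.cmod_char_le_1[OF real_distribution_inner[OF assms], of u 1]
  by (simp add: char_distr_inner[OF assms])

lemma char_fun_zero: "prob_law \<mu> \<Longrightarrow> char_fun \<mu> 0 = 1"
  by (simp add: char_fun_def prob_law_def prob_space.prob_space)

text \<open>Along a ray, \<open>\<psi> t = \<phi> (t powr (1 / \<alpha>) *\<^sub>R u)\<close> is multiplicative and real. It is near \<open>1\<close> for
  small \<open>t\<close>, so \<open>\<psi> t = \<psi> (t / n) ^ n\<close> is positive, and \<open>- ln (\<psi> t)\<close> is additive and nonnegative,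
  hence linear in \<open>t\<close>.\<close>

lemma stable_exponent:
  fixes \<mu> :: "(real ^ 'd) measure"
  assumes \<mu>: "prob_law \<mu>" and stable: "sym_stable \<alpha> \<mu>" and "0 < \<alpha>"
  obtains f where "\<And>u. char_fun \<mu> u = complex_of_real (exp (- f u))" and "\<And>u. 0 \<le> f u"
    and "\<And>c u. 0 < c \<Longrightarrow> f (c *\<^sub>R u) = c powr \<alpha> * f u"
proof -
  have even: "char_fun \<mu> (- u) = char_fun \<mu> u" for u
    using stable by (simp add: sym_stable_iff_char_fun[OF \<mu>])
  have split: "char_fun \<mu> (a powr (1 / \<alpha>) *\<^sub>R u) * char_fun \<mu> (b powr (1 / \<alpha>) *\<^sub>R u)
      = char_fun \<mu> ((a + b) powr (1 / \<alpha>) *\<^sub>R u)" if "0 < a" "0 < b" for a b u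
    using stable that by (simp add: sym_stable_iff_char_fun[OF \<mu>])
  define g where "g u = Re (char_fun \<mu> u)" for u
  have "Im (char_fun \<mu> u) = 0" for u
    using arg_cong[OF even[of u], of Im] by (simp add: char_fun_Re_Im[OF \<mu>])
  then have g: "char_fun \<mu> u = complex_of_real (g u)" for u
    by (simp add: g_def complex_eq_iff)
  have g_le: "\<bar>g u\<bar> \<le> 1" for u
    using norm_char_fun_le_1[OF \<mu>, of u] by (simp add: g)
  define \<psi> where "\<psi> u t = g (t powr (1 / \<alpha>) *\<^sub>R u)" for u t
  have \<psi>_add: "\<psi> u (a + b) = \<psi> u a * \<psi> u b" if "0 < a" "0 < b" for a b u
    using split[OF that, of u] unfolding g \<psi>_def by (metis of_real_eq_iff of_real_mult)
  have \<psi>_mult: "\<psi> u (real (Suc n) * t) = \<psi> u t ^ Suc n" if "0 < t" for u t n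
  proof (induction n)
    case (Suc n)
    have "\<psi> u (real (Suc (Suc n)) * t) = \<psi> u (t + real (Suc n) * t)" by (simp add: algebra_simps)
    also have "\<dots> = \<psi> u t * \<psi> u (real (Suc n) * t)" using that by (intro \<psi>_add) auto
    finally show ?case using Suc by simp
  qed simp
  have \<psi>_pos: "0 < \<psi> u t" if "0 < t" for u t
  proof -
    have "isCont (char (distr \<mu> borel ((\<bullet>) u))) 0"
      by (rule real_distribution.isCont_char[OF real_distribution_inner[OF \<mu>]])
    moreover have "(\<lambda>n. (t / real (Suc n)) powr (1 / \<alpha>)) \<longlonglongrightarrow> 0"
      using \<open>0 < t\<close> \<open>0 < \<alpha>\<close> by real_asymp
    ultimately have "(\<lambda>n. char (distr \<mu> borel ((\<bullet>) u)) ((t / real (Suc n)) powr (1 / \<alpha>)))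
        \<longlonglongrightarrow> char (distr \<mu> borel ((\<bullet>) u)) 0"
      by (rule isCont_tendsto_compose)
    then have "(\<lambda>n. complex_of_real (\<psi> u (t / real (Suc n)))) \<longlonglongrightarrow> complex_of_real 1"
      by (simp only: char_distr_inner[OF \<mu>] g \<psi>_def[symmetric]) (simp add: char_fun_zero[OF \<mu>] flip: g)
    then have "(\<lambda>n. \<psi> u (t / real (Suc n))) \<longlonglongrightarrow> 1" by (simp only: tendsto_of_real_iff)
    then have "\<forall>\<^sub>F n in sequentially. 0 < \<psi> u (t / real (Suc n))"
      by (rule order_tendstoD) simp
    then obtain n where "0 < \<psi> u (t / real (Suc n))" by (auto simp: eventually_sequentially)
    then have "0 < \<psi> u (t / real (Suc n)) ^ Suc n" by (rule zero_less_power)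
    also have "\<dots> = \<psi> u (real (Suc n) * (t / real (Suc n)))"
      using \<open>0 < t\<close> by (intro \<psi>_mult[symmetric]) auto
    finally show ?thesis by simp
  qed
  define f where "f u = - ln (g u)" for u
  have \<psi>1: "\<psi> u 1 = g u" for u by (simp add: \<psi>_def)
  then have g_pos: "0 < g u" for u using \<psi>_pos[of 1 u] by simp
  have linear: "- ln (\<psi> u t) = t * - ln (\<psi> u 1)" if "0 < t" for u t
  proof (rule additive_nonneg_linear[of "\<lambda>t. - ln (\<psi> u t)"])
    show "- ln (\<psi> u (s + t)) = - ln (\<psi> u s) + - ln (\<psi> u t)" if "0 < s" "0 < t" for s t
      unfolding \<psi>_add[OF that] using \<psi>_pos[OF that(1), of u] \<psi>_pos[OF that(2), of u]
      by (subst ln_mult) auto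
    show "0 \<le> - ln (\<psi> u t)" if "0 < t" for t
      using \<psi>_pos[OF that, of u] g_le[of "t powr (1 / \<alpha>) *\<^sub>R u"] by (simp add: \<psi>_def abs_le_iff)
  qed fact
  show ?thesis
  proof
    show "char_fun \<mu> u = complex_of_real (exp (- f u))" for u
      using g_pos[of u] by (simp add: g f_def)
    show "0 \<le> f u" for u using g_pos[of u] g_le[of u] by (simp add: f_def abs_le_iff)
    show "f (c *\<^sub>R u) = c powr \<alpha> * f u" if "0 < c" for c u
    proof -
      have "\<psi> u (c powr \<alpha>) = g (c *\<^sub>R u)" using that \<open>0 < \<alpha>\<close> by (simp add: \<psi>_def powr_powr)
      then show ?thesis using linear[of "c powr \<alpha>" u] that by (simp add: f_def \<psi>1)
    qed
  qed
qed

section \<open>Absolute moments of stable laws\<close>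

lemma one_minus_cos_le: "1 - cos r \<le> r\<^sup>2 / (2 :: real)"
proof -
  have "1 - cos r = 2 * (sin (r / 2))\<^sup>2" using cos_double_sin[of "r / 2"] by simp
  also have "(sin (r / 2))\<^sup>2 \<le> (r / 2)\<^sup>2"
    using abs_sin_x_le_abs_x[of "r / 2"] unfolding abs_le_square_iff .
  finally show ?thesis by (simp add: power_divide)
qed

text \<open>Integrate \<open>1 - cos (r * (u \<bullet> x))\<close> over \<open>r\<close> against the Levy measure and over \<open>x\<close> against \<open>\<mu>\<close>.
  Taking \<open>r\<close> first, scaling gives a multiple \<open>K\<close> of \<open>\<bar>u \<bullet> x\<bar> powr p\<close>, because \<open>p < 2\<close>. Taking \<open>x\<close>
  first gives \<open>1 - exp (- (r powr \<alpha> * f u))\<close>, which scales to a multiple \<open>M\<close> of \<open>f u powr (p / \<alpha>)\<close>,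
  because \<open>p < \<alpha>\<close>. The constant \<open>C = K / M\<close> does not depend on \<open>u\<close>.\<close>

lemma stable_moment:
  fixes \<mu> :: "(real ^ 'd) measure"
  assumes \<mu>: "prob_law \<mu>" and p: "0 < p" "p < \<alpha>" and "\<alpha> \<le> 2"
    and f: "\<And>u. char_fun \<mu> u = complex_of_real (exp (- f u))" "\<And>u. 0 \<le> f u"
      "\<And>c u. 0 < c \<Longrightarrow> f (c *\<^sub>R u) = c powr \<alpha> * f u"
  obtains C where "0 < C" and "\<And>u. integrable \<mu> (\<lambda>x. \<bar>u \<bullet> x\<bar> powr p)"
    and "\<And>u. C * (LINT x|\<mu>. \<bar>u \<bullet> x\<bar> powr p) = f u powr (p / \<alpha>)"
proof -
  interpret prob_space \<mu> using \<mu> by (simp add: prob_law_def)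
  interpret levy: sigma_finite_measure "levy_measure p" by (rule sigma_finite_levy_measure)
  interpret pair_sigma_finite \<mu> "levy_measure p" ..
  have sets [measurable_cong]: "sets \<mu> = sets borel" using \<mu> by (simp add: prob_law_def)
  define K where "K = (LINT r|levy_measure p. 1 - cos r)"
  define M where "M = (LINT r|levy_measure p. 1 - exp (- (r powr \<alpha>)))"
  have int_K: "integrable (levy_measure p) (\<lambda>r. 1 - cos r)"
  proof (rule integrable_levy_measure)
    show "\<bar>1 - cos r\<bar> \<le> 2 * min 1 (r powr 2)" if "0 < r" for r :: real
    proof -
      have "1 - cos r \<le> 2 * r\<^sup>2" using one_minus_cos_le[of r] zero_le_power2[of r] by linarith
      moreover have "1 - cos r \<le> 2" using cos_ge_minus_one[of r] by simp
      ultimately show ?thesis using that by (simp add: powr_numeral min_def)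
    qed
  qed (use p \<open>\<alpha> \<le> 2\<close> in auto)
  have int_M: "integrable (levy_measure p) (\<lambda>r. 1 - exp (- (r powr \<alpha>)))"
  proof (rule integrable_levy_measure)
    show "\<bar>1 - exp (- (r powr \<alpha>))\<bar> \<le> 1 * min 1 (r powr \<alpha>)" if "0 < r" for r :: real
      using one_minus_exp_le_min[of "r powr \<alpha>"] by simp
  qed (use p in auto)
  have "0 < K" unfolding K_def
  proof (rule levy_integral_pos[OF int_K])
    show "0 < 1 - cos r" if "0 < r" "r < 1" for r :: real
      using cos_monotone_0_pi[of 0 r] that pi_gt3 by simp
  qed auto
  have "0 < M" unfolding M_def
    by (rule levy_integral_pos[OF int_M]) auto
  have main: "ennreal K * (\<integral>\<^sup>+x. ennreal (\<bar>u \<bullet> x\<bar> powr p) \<partial>\<mu>) = ennreal (f u powr (p / \<alpha>) * M)" for u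
  proof -
    have "ennreal K * (\<integral>\<^sup>+x. ennreal (\<bar>u \<bullet> x\<bar> powr p) \<partial>\<mu>)
        = (\<integral>\<^sup>+x. ennreal (\<bar>u \<bullet> x\<bar> powr p) * ennreal K \<partial>\<mu>)"
      by (subst nn_integral_multc) (auto simp: mult.commute)
    also have "\<dots> = (\<integral>\<^sup>+x. \<integral>\<^sup>+r. ennreal (1 - cos (r * (u \<bullet> x))) \<partial>levy_measure p \<partial>\<mu>)"
    proof (rule nn_integral_cong)
      fix x
      show "ennreal (\<bar>u \<bullet> x\<bar> powr p) * ennreal K = (\<integral>\<^sup>+r. ennreal (1 - cos (r * (u \<bullet> x))) \<partial>levy_measure p)"
      proof (cases "u \<bullet> x = 0")
        case False
        have "(\<integral>\<^sup>+r. ennreal (1 - cos (r * (u \<bullet> x))) \<partial>levy_measure p)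
            = (\<integral>\<^sup>+r. (\<lambda>r. ennreal (1 - cos r)) (\<bar>u \<bullet> x\<bar> * r) \<partial>levy_measure p)"
          by (rule nn_integral_cong) (simp add: abs_if mult.commute)
        also have "\<dots> = ennreal (\<bar>u \<bullet> x\<bar> powr p) * (\<integral>\<^sup>+r. ennreal (1 - cos r) \<partial>levy_measure p)"
          by (rule levy_measure_scale) (use False in auto)
        also have "(\<integral>\<^sup>+r. ennreal (1 - cos r) \<partial>levy_measure p) = ennreal K"
          unfolding K_def by (rule nn_integral_eq_integral[OF int_K]) simp
        finally show ?thesis ..
      qed simp
    qed
    also have "\<dots> = (\<integral>\<^sup>+r. \<integral>\<^sup>+x. ennreal (1 - cos (r * (u \<bullet> x))) \<partial>\<mu> \<partial>levy_measure p)"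
      by (rule Fubini'[symmetric]) measurable
    also have "\<dots> = (\<integral>\<^sup>+r. ennreal (1 - exp (- (r powr \<alpha> * f u))) \<partial>levy_measure p)"
    proof (rule nn_integral_cong_AE)
      show "AE r in levy_measure p. (\<integral>\<^sup>+x. ennreal (1 - cos (r * (u \<bullet> x))) \<partial>\<mu>)
          = ennreal (1 - exp (- (r powr \<alpha> * f u)))"
        using AE_levy_measure_pos
      proof eventually_elim
        case (elim r)
        have int: "integrable \<mu> (\<lambda>x. cos (r * (u \<bullet> x)))"
          by (rule integrable_const_bound[of _ 1]) auto
        have "(\<integral>\<^sup>+x. ennreal (1 - cos (r * (u \<bullet> x))) \<partial>\<mu>) = ennreal (LINT x|\<mu>. 1 - cos (r * (u \<bullet> x)))"
          using int by (intro nn_integral_eq_integral) auto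
        also have "(LINT x|\<mu>. 1 - cos (r * (u \<bullet> x))) = 1 - Re (char_fun \<mu> (r *\<^sub>R u))"
          using int by (simp add: char_fun_Re_Im[OF \<mu>] prob_space)
        finally show ?case by (simp add: f(1) f(3)[OF elim])
      qed
    qed
    also have "\<dots> = ennreal (f u powr (p / \<alpha>)) * ennreal M"
    proof (cases "f u = 0")
      case False
      then have "0 < f u" using f(2)[of u] by simp
      have "(\<integral>\<^sup>+r. ennreal (1 - exp (- (r powr \<alpha> * f u))) \<partial>levy_measure p)
          = (\<integral>\<^sup>+r. (\<lambda>r. ennreal (1 - exp (- (r powr \<alpha>)))) (f u powr (1 / \<alpha>) * r) \<partial>levy_measure p)"
        using AE_levy_measure_pos
        by (intro nn_integral_cong_AE, eventually_elim)
          (use \<open>0 < f u\<close> p in \<open>simp add: powr_mult powr_powr mult.commute\<close>)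
      also have "\<dots> = ennreal ((f u powr (1 / \<alpha>)) powr p) * (\<integral>\<^sup>+r. ennreal (1 - exp (- (r powr \<alpha>))) \<partial>levy_measure p)"
        by (rule levy_measure_scale) (use \<open>0 < f u\<close> in auto)
      also have "(\<integral>\<^sup>+r. ennreal (1 - exp (- (r powr \<alpha>))) \<partial>levy_measure p) = ennreal M"
        unfolding M_def by (rule nn_integral_eq_integral[OF int_M]) simp
      finally show ?thesis by (simp add: powr_powr)
    qed (use p in simp)
    finally show ?thesis by (simp add: ennreal_mult \<open>0 < M\<close> less_imp_le)
  qed
  show ?thesis
  proof
    show "0 < K / M" using \<open>0 < K\<close> \<open>0 < M\<close> by simp
    fix u
    have meas: "(\<lambda>x. \<bar>u \<bullet> x\<bar> powr p) \<in> borel_measurable \<mu>" by measurable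
    have "(\<integral>\<^sup>+x. ennreal (\<bar>u \<bullet> x\<bar> powr p) \<partial>\<mu>) \<noteq> \<infinity>"
    proof
      assume "(\<integral>\<^sup>+x. ennreal (\<bar>u \<bullet> x\<bar> powr p) \<partial>\<mu>) = \<infinity>"
      then show False using main[of u] \<open>0 < K\<close> by (simp add: ennreal_mult_top)
    qed
    then show int: "integrable \<mu> (\<lambda>x. \<bar>u \<bullet> x\<bar> powr p)"
      using meas by (intro integrableI_bounded) (auto simp: less_top)
    have "ennreal (K * (LINT x|\<mu>. \<bar>u \<bullet> x\<bar> powr p)) = ennreal (f u powr (p / \<alpha>) * M)"
      using main[of u] nn_integral_eq_integral[OF int] \<open>0 < K\<close> by (simp add: ennreal_mult integral_nonneg)
    then have "K * (LINT x|\<mu>. \<bar>u \<bullet> x\<bar> powr p) = f u powr (p / \<alpha>) * M"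
      using \<open>0 < K\<close> \<open>0 < M\<close> by (simp add: integral_nonneg)
    then show "K / M * (LINT x|\<mu>. \<bar>u \<bullet> x\<bar> powr p) = f u powr (p / \<alpha>)"
      using \<open>0 < M\<close> by (simp add: field_simps)
  qed
qed

lemma sum_powr_le:
  fixes t :: "'a \<Rightarrow> real"
  assumes "finite A" and "\<And>i. i \<in> A \<Longrightarrow> 0 \<le> t i" and "0 < p"
  shows "(\<Sum>i\<in>A. t i) powr p \<le> real (card A) powr p * (\<Sum>i\<in>A. t i powr p)"
proof (cases "A = {}")
  case False
  have "Max (t ` A) \<in> t ` A" using assms(1) False by (intro Max_in) auto
  then obtain j where "j \<in> A" "Max (t ` A) = t j" by blast
  then have j: "j \<in> A" "\<And>i. i \<in> A \<Longrightarrow> t i \<le> t j"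
    using Max_ge[of "t ` A"] assms(1) by auto
  have "(\<Sum>i\<in>A. t i) powr p \<le> (real (card A) * t j) powr p"
    using assms j sum_bounded_above[of A t "t j"] by (intro powr_mono2 sum_nonneg) auto
  also have "\<dots> = real (card A) powr p * t j powr p" using assms j by (simp add: powr_mult)
  also have "t j powr p \<le> (\<Sum>i\<in>A. t i powr p)"
    using assms j by (intro member_le_sum[of j A "\<lambda>i. t i powr p"]) auto
  finally show ?thesis by (simp add: mult_left_mono)
qed (use assms in simp)

lemma norm_powr_le:
  fixes x :: "real ^ 'd"
  assumes "0 < p" and "p \<le> 2"
  shows "norm x powr p \<le> (real CARD('d))\<^sup>2 * (\<Sum>i\<in>UNIV. \<bar>axis i 1 \<bullet> x\<bar> powr p)"
proof -
  have "norm x powr p \<le> (\<Sum>i\<in>UNIV. \<bar>x $ i\<bar>) powr p"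
    using assms by (intro powr_mono2 norm_le_l1_cart) auto
  also have "\<dots> \<le> real CARD('d) powr p * (\<Sum>i\<in>UNIV. \<bar>x $ i\<bar> powr p)"
    using assms by (intro sum_powr_le) auto
  also have "real CARD('d) powr p \<le> real CARD('d) powr 2"
    using assms by (intro powr_mono) auto
  finally show ?thesis by (simp add: inner_axis' mult_right_mono sum_nonneg)
qed

text \<open>The bound is uniform in \<open>p\<close>, although the constant \<open>C\<close> may tend to \<open>0\<close> and the moment to
  infinity as \<open>p\<close> approaches \<open>\<alpha>\<close>: the product is controlled by \<open>f\<close> on the coordinate axes.\<close>

lemma stable_norm_moment:
  fixes \<mu> :: "(real ^ 'd) measure"
  assumes \<mu>: "prob_law \<mu>" and p: "0 < p" "p < \<alpha>" and "\<alpha> \<le> 2" and "0 < C"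
    and int: "\<And>u. integrable \<mu> (\<lambda>x. \<bar>u \<bullet> x\<bar> powr p)"
    and mom: "\<And>u. C * (LINT x|\<mu>. \<bar>u \<bullet> x\<bar> powr p) = f u powr (p / \<alpha>)"
    and f: "\<And>u. 0 \<le> f u"
  shows "integrable \<mu> (\<lambda>x. norm x powr p)"
    and "C * (LINT x|\<mu>. norm x powr p) \<le> (real CARD('d))\<^sup>2 * (\<Sum>i\<in>UNIV. max 1 (f (axis i 1)))"
proof -
  have int_sum: "integrable \<mu> (\<lambda>x. (real CARD('d))\<^sup>2 * (\<Sum>i\<in>UNIV. \<bar>axis i 1 \<bullet> x\<bar> powr p))"
    using int by simp
  have le: "norm x powr p \<le> (real CARD('d))\<^sup>2 * (\<Sum>i\<in>UNIV. \<bar>axis i 1 \<bullet> x\<bar> powr p)" for x :: "real ^ 'd"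
    using p \<open>\<alpha> \<le> 2\<close> by (intro norm_powr_le) auto
  show int_norm: "integrable \<mu> (\<lambda>x. norm x powr p)"
  proof (rule Bochner_Integration.integrable_bound[OF int_sum])
    show "(\<lambda>x. norm x powr p) \<in> borel_measurable \<mu>" by (rule measurable_prob_law[OF \<mu>]) simp
    show "AE x in \<mu>. norm (norm x powr p) \<le> norm ((real CARD('d))\<^sup>2 * (\<Sum>i\<in>UNIV. \<bar>axis i 1 \<bullet> x\<bar> powr p))"
      using le by (intro AE_I2) (auto intro: order_trans[OF _ abs_ge_self])
  qed
  have "(LINT x|\<mu>. norm x powr p) \<le> (LINT x|\<mu>. (real CARD('d))\<^sup>2 * (\<Sum>i\<in>UNIV. \<bar>axis i 1 \<bullet> x\<bar> powr p))"
    by (intro integral_mono int_norm int_sum le)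
  also have "\<dots> = (real CARD('d))\<^sup>2 * (\<Sum>i\<in>UNIV. LINT x|\<mu>. \<bar>axis i 1 \<bullet> x\<bar> powr p)"
    using int by simp
  finally have "C * (LINT x|\<mu>. norm x powr p)
      \<le> C * ((real CARD('d))\<^sup>2 * (\<Sum>i\<in>UNIV. LINT x|\<mu>. \<bar>axis i 1 \<bullet> x\<bar> powr p))"
    using \<open>0 < C\<close> by (intro mult_left_mono) auto
  also have "\<dots> = (real CARD('d))\<^sup>2 * (\<Sum>i\<in>UNIV. f (axis i 1) powr (p / \<alpha>))"
    by (simp add: mom[symmetric] sum_distrib_left mult.left_commute)
  also have "\<dots> \<le> (real CARD('d))\<^sup>2 * (\<Sum>i\<in>UNIV. max 1 (f (axis i 1)))"
  proof (intro mult_left_mono sum_mono)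
    fix i :: 'd
    have "f (axis i 1) powr (p / \<alpha>) \<le> max 1 (f (axis i 1)) powr (p / \<alpha>)"
      using p f by (intro powr_mono2) auto
    also have "\<dots> \<le> max 1 (f (axis i 1)) powr 1" using p by (intro powr_mono) auto
    finally show "f (axis i 1) powr (p / \<alpha>) \<le> max 1 (f (axis i 1))" by simp
  qed simp
  finally show "C * (LINT x|\<mu>. norm x powr p) \<le> (real CARD('d))\<^sup>2 * (\<Sum>i\<in>UNIV. max 1 (f (axis i 1)))" .
qed

section \<open>Discretising the directions\<close>

text \<open>The direction of \<open>x\<close> with its coordinates rounded down to multiples of \<open>1 / (k + 1)\<close>, so that
  only finitely many values occur.\<close>

definition sgn_grid :: "nat \<Rightarrow> real ^ 'd \<Rightarrow> real ^ 'd" where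
  "sgn_grid k x = (\<chi> i. real_of_int \<lfloor>real (Suc k) * sgn x $ i\<rfloor> / real (Suc k))"

lemma norm_sgn_grid_diff: "norm (sgn_grid k x - sgn x :: real ^ 'd) \<le> real CARD('d) / real (Suc k)"
proof -
  have "\<bar>(sgn_grid k x - sgn x) $ i\<bar> \<le> 1 / real (Suc k)" for i
  proof -
    have "(sgn_grid k x - sgn x) $ i
        = (real_of_int \<lfloor>real (Suc k) * sgn x $ i\<rfloor> - real (Suc k) * sgn x $ i) / real (Suc k)"
      by (simp add: sgn_grid_def diff_divide_distrib del: of_nat_Suc)
    also have "\<bar>\<dots>\<bar> = \<bar>real_of_int \<lfloor>real (Suc k) * sgn x $ i\<rfloor> - real (Suc k) * sgn x $ i\<bar> / real (Suc k)"
      by (simp add: abs_divide)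
    also have "\<dots> \<le> 1 / real (Suc k)"
      by (intro divide_right_mono) linarith+
    finally show ?thesis .
  qed
  then have "(\<Sum>i\<in>UNIV. \<bar>(sgn_grid k x - sgn x) $ i\<bar>) \<le> (\<Sum>i\<in>(UNIV :: 'd set). 1 / real (Suc k))"
    by (intro sum_mono)
  then show ?thesis using norm_le_l1_cart[of "sgn_grid k x - sgn x"] by simp
qed

lemma finite_range_sgn_grid: "finite (range (sgn_grid k :: real ^ 'd \<Rightarrow> real ^ 'd))"
proof -
  let ?J = "(\<lambda>j. real_of_int j / real (Suc k)) ` {- int (Suc k) .. int (Suc k)}"
  have "sgn_grid k x $ i \<in> ?J" for x :: "real ^ 'd" and i
  proof -
    have "\<bar>sgn x $ i\<bar> \<le> 1" using component_le_norm_cart[of "sgn x" i] norm_sgn[of x] by (auto split: if_splits)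
    then have "- real (Suc k) \<le> real (Suc k) * sgn x $ i" "real (Suc k) * sgn x $ i \<le> real (Suc k)"
      using mult_left_mono[of "-1" "sgn x $ i" "real (Suc k)"] mult_left_mono[of "sgn x $ i" 1 "real (Suc k)"]
      by (auto simp: abs_le_iff simp del: of_nat_Suc)
    then have "\<lfloor>real (Suc k) * sgn x $ i\<rfloor> \<in> {- int (Suc k) .. int (Suc k)}"
      unfolding atLeastAtMost_iff le_floor_iff floor_le_iff of_int_minus of_int_of_nat_eq
      by (intro conjI) linarith+
    then show ?thesis unfolding sgn_grid_def by (simp del: of_nat_Suc)
  qed
  then have "range (sgn_grid k :: real ^ 'd \<Rightarrow> real ^ 'd) \<subseteq> vec_lambda ` (UNIV \<rightarrow>\<^sub>E ?J)"
  proof (intro image_subsetI)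
    fix x :: "real ^ 'd"
    assume mem: "\<And>x i. sgn_grid k (x :: real ^ 'd) $ i \<in> ?J"
    have "sgn_grid k x = vec_lambda (vec_nth (sgn_grid k x))" by (simp add: vec_eq_iff)
    moreover have "vec_nth (sgn_grid k x) \<in> UNIV \<rightarrow>\<^sub>E ?J" using mem[of x] by (auto simp: PiE_UNIV_domain)
    ultimately show "sgn_grid k x \<in> vec_lambda ` (UNIV \<rightarrow>\<^sub>E ?J)" by (rule image_eqI)
  qed
  then show ?thesis by (rule finite_subset) (intro finite_imageI finite_PiE; simp)
qed

lemma sgn_grid_measurable [measurable]: "sgn_grid k \<in> borel_measurable borel"
  unfolding sgn_grid_def by (rule borel_measurable_vec) (simp add: sgn_div_norm)

text \<open>The mass of \<open>W\<close> on the points sent to \<open>v\<close> is absorbed into the length of \<open>v\<close> by homogeneity.\<close>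

lemma finite_directions_integral:
  fixes q :: "real ^ 'd \<Rightarrow> real ^ 'd" and W :: "real ^ 'd \<Rightarrow> real"
  assumes \<mu>: "prob_law \<mu>" and "0 < \<alpha>" and q: "finite (range q)" "q \<in> borel_measurable borel"
    and W: "integrable \<mu> W" "\<And>x. 0 \<le> W x"
  shows "\<exists>n w. 0 < n \<and>
    (\<forall>u. (LINT x|\<mu>. W x * \<bar>u \<bullet> q x\<bar> powr \<alpha>) = (\<Sum>i<(n::nat). \<bar>u \<bullet> w i\<bar> powr \<alpha>))"
proof -
  define m where "m v = (LINT x|\<mu>. W x * indicator (q -` {v}) x)" for v
  have "q -` {v} \<in> sets borel" for v using q(2) by (auto intro: measurable_sets_borel)
  then have sets: "q -` {v} \<in> sets \<mu>" for v using \<mu> by (simp add: prob_law_def)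
  have int: "integrable \<mu> (\<lambda>x. W x * indicator (q -` {v}) x)" for v
    by (rule integrable_real_mult_indicator[OF sets W(1)])
  have m_nonneg: "0 \<le> m v" for v unfolding m_def by (intro Bochner_Integration.integral_nonneg) (simp add: W(2))
  obtain h where h: "bij_betw h {..<card (range q)} (range q)"
    using ex_bij_betw_nat_finite[OF q(1)] by (auto simp: atLeast0LessThan)
  define w where "w i = (m (h i) powr (1 / \<alpha>)) *\<^sub>R h i" for i
  have "(LINT x|\<mu>. W x * \<bar>u \<bullet> q x\<bar> powr \<alpha>) = (\<Sum>i<card (range q). \<bar>u \<bullet> w i\<bar> powr \<alpha>)" for u
  proof -
    have "W x * \<bar>u \<bullet> q x\<bar> powr \<alpha> = (\<Sum>v\<in>range q. \<bar>u \<bullet> v\<bar> powr \<alpha> * (W x * indicator (q -` {v}) x))" for x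
    proof -
      have "(\<Sum>v\<in>range q. \<bar>u \<bullet> v\<bar> powr \<alpha> * (W x * indicator (q -` {v}) x))
          = (\<Sum>v\<in>{q x}. \<bar>u \<bullet> v\<bar> powr \<alpha> * (W x * indicator (q -` {v}) x))"
        by (rule sum.mono_neutral_right) (use q(1) in \<open>auto simp: indicator_def\<close>)
      then show ?thesis by simp
    qed
    then have "(LINT x|\<mu>. W x * \<bar>u \<bullet> q x\<bar> powr \<alpha>) = (\<Sum>v\<in>range q. \<bar>u \<bullet> v\<bar> powr \<alpha> * m v)"
      using int by (simp add: m_def)
    also have "\<dots> = (\<Sum>i<card (range q). \<bar>u \<bullet> h i\<bar> powr \<alpha> * m (h i))"
      by (rule sum.reindex_bij_betw[OF h, symmetric])
    also have "\<dots> = (\<Sum>i<card (range q). \<bar>u \<bullet> w i\<bar> powr \<alpha>)"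
      using m_nonneg \<open>0 < \<alpha>\<close>
      by (intro sum.cong) (auto simp: w_def abs_mult powr_mult powr_powr)
    finally show ?thesis .
  qed
  moreover have "0 < card (range q)" using q(1) by (simp add: card_gt_0_iff)
  ultimately show ?thesis by blast
qed

text \<open>The base may be \<open>0\<close>, where \<open>powr\<close> is jointly continuous only for positive exponents; therefore the
  exponents are kept above \<open>a / 2\<close>.\<close>

lemma powr_uniformly_continuous:
  assumes "0 < a" and "0 < (e :: real)"
  obtains d where "0 < d" and "\<And>s t p. s \<in> {0..R} \<Longrightarrow> t \<in> {0..R} \<Longrightarrow> p \<in> {a / 2..a} \<Longrightarrow>
    \<bar>s - t\<bar> < d \<Longrightarrow> \<bar>p - a\<bar> < d \<Longrightarrow> \<bar>s powr p - t powr a\<bar> < e"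
proof -
  have "uniformly_continuous_on ({0..R} \<times> {a / 2..a}) (\<lambda>z. fst z powr snd z)"
  proof (rule compact_uniformly_continuous)
    show "continuous_on ({0..R} \<times> {a / 2..a}) (\<lambda>z. fst z powr snd z)"
      by (rule continuous_on_powr') (use \<open>0 < a\<close> in \<open>auto intro!: continuous_intros\<close>)
    show "compact ({0..R} \<times> {a / 2..a})" by (intro compact_Times) auto
  qed
  then obtain d where "0 < d" and d: "\<And>y z. y \<in> {0..R} \<times> {a / 2..a} \<Longrightarrow> z \<in> {0..R} \<times> {a / 2..a} \<Longrightarrow>
      dist y z < d \<Longrightarrow> dist (fst y powr snd y) (fst z powr snd z) < e"
    unfolding uniformly_continuous_on_def using \<open>0 < e\<close> by metis
  show ?thesis
  proof
    show "0 < d / 2" using \<open>0 < d\<close> by simp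
    fix s t p assume *: "s \<in> {0..R}" "t \<in> {0..R}" "p \<in> {a / 2..a}" "\<bar>s - t\<bar> < d / 2" "\<bar>p - a\<bar> < d / 2"
    have "dist (s, p) (t, a) \<le> dist s t + dist p a"
      unfolding dist_Pair_Pair by (rule sqrt_sum_squares_le_sum) auto
    also have "\<dots> < d" using * by (simp add: dist_real_def)
    finally show "\<bar>s powr p - t powr a\<bar> < e"
      using d[of "(s, p)" "(t, a)"] * \<open>0 < a\<close> by (simp add: dist_real_def)
  qed
qed

text \<open>Polar coordinates turn \<open>f u powr (p / \<alpha>) = C * E \<bar>u \<bullet> X\<bar> powr p\<close> into an integral of
  \<open>\<bar>u \<bullet> sgn x\<bar> powr p\<close> against a measure of bounded mass. Along \<open>p k\<close> increasing to \<open>\<alpha>\<close>, the integrand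
  is uniformly close to \<open>\<bar>u \<bullet> sgn_grid k x\<bar> powr \<alpha>\<close>.\<close>

lemma stable_exponent_approx:
  fixes \<mu> :: "(real ^ 'd) measure"
  assumes \<mu>: "prob_law \<mu>" and "0 < \<alpha>" and "\<alpha> \<le> 2"
    and f: "\<And>u. char_fun \<mu> u = complex_of_real (exp (- f u))" "\<And>u. 0 \<le> f u"
      "\<And>c u. 0 < c \<Longrightarrow> f (c *\<^sub>R u) = c powr \<alpha> * f u"
  obtains n :: "nat \<Rightarrow> nat" and w :: "nat \<Rightarrow> nat \<Rightarrow> real ^ 'd" where "\<And>k. 0 < n k"
    and "\<And>u. (\<lambda>k. \<Sum>i<n k. \<bar>u \<bullet> w k i\<bar> powr \<alpha>) \<longlonglongrightarrow> f u"
proof -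
  define p where "p k = \<alpha> * (1 - 1 / real (k + 2))" for k
  have p: "0 < p k" "p k < \<alpha>" "p k \<in> {\<alpha> / 2..\<alpha>}" for k
  proof -
    define h where "h = 1 / real (k + 2)"
    have "0 < h" "h \<le> 1 / 2" unfolding h_def by (auto simp: divide_le_eq)
    then have "\<alpha> * (1 - h) < \<alpha> * 1" "\<alpha> * (1 / 2) \<le> \<alpha> * (1 - h)"
      using \<open>0 < \<alpha>\<close> by (intro mult_strict_left_mono mult_left_mono; simp)+
    then show "0 < p k" "p k < \<alpha>" "p k \<in> {\<alpha> / 2..\<alpha>}"
      using \<open>0 < \<alpha>\<close> unfolding p_def h_def by auto
  qed
  have p_lim: "p \<longlonglongrightarrow> \<alpha>"
    unfolding p_def by real_asymp
  have "\<exists>C. 0 < C \<and> (\<forall>u. integrable \<mu> (\<lambda>x. \<bar>u \<bullet> x\<bar> powr p k)) \<and>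
      (\<forall>u. C * (LINT x|\<mu>. \<bar>u \<bullet> x\<bar> powr p k) = f u powr (p k / \<alpha>))" for k
    using stable_moment[OF \<mu> p(1,2)[of k] \<open>\<alpha> \<le> 2\<close> f] by metis
  then obtain C where C: "\<And>k. 0 < C k" "\<And>k u. integrable \<mu> (\<lambda>x. \<bar>u \<bullet> x\<bar> powr p k)"
    "\<And>k u. C k * (LINT x|\<mu>. \<bar>u \<bullet> x\<bar> powr p k) = f u powr (p k / \<alpha>)"
    by metis
  define B where "B = (real CARD('d))\<^sup>2 * (\<Sum>i\<in>UNIV. max 1 (f (axis i 1)))"
  have "0 \<le> B" unfolding B_def by (intro mult_nonneg_nonneg sum_nonneg) auto
  have norm_int: "integrable \<mu> (\<lambda>x. norm x powr p k)"
    and norm_le: "C k * (LINT x|\<mu>. norm x powr p k) \<le> B" for k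
    unfolding B_def using stable_norm_moment[OF \<mu> p(1,2) \<open>\<alpha> \<le> 2\<close> C f(2)] by blast+
  define P where "P k n w \<longleftrightarrow> 0 < n \<and>
      (\<forall>u. (LINT x|\<mu>. C k * norm x powr p k * \<bar>u \<bullet> sgn_grid k x\<bar> powr \<alpha>) = (\<Sum>i<n. \<bar>u \<bullet> w i\<bar> powr \<alpha>))"
    for k n :: nat and w :: "nat \<Rightarrow> real ^ 'd"
  have "\<exists>n w. P k n w" for k
  proof -
    have int: "integrable \<mu> (\<lambda>x. C k * norm x powr p k)" using norm_int by simp
    have nonneg: "0 \<le> C k * norm x powr p k" for x :: "real ^ 'd" using C(1)[of k] by simp
    show ?thesis unfolding P_def
      by (rule finite_directions_integral[OF \<mu> \<open>0 < \<alpha>\<close> finite_range_sgn_grid sgn_grid_measurable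
            int nonneg])
  qed
  then obtain n w where "\<And>k. P k (n k) (w k)" by metis
  then have n: "\<And>k. 0 < n k" and w: "\<And>k u.
      (LINT x|\<mu>. C k * norm x powr p k * \<bar>u \<bullet> sgn_grid k x\<bar> powr \<alpha>) = (\<Sum>i<n k. \<bar>u \<bullet> w k i\<bar> powr \<alpha>)"
    unfolding P_def by blast+
  have meas_grid: "(\<lambda>x. \<bar>u \<bullet> sgn_grid k x\<bar> powr \<alpha>) \<in> borel_measurable \<mu>" for u k
    by (rule measurable_prob_law[OF \<mu>]) simp
  have meas_sgn: "(\<lambda>x. \<bar>u \<bullet> sgn x\<bar> powr p k) \<in> borel_measurable \<mu>" for u k
    by (rule measurable_prob_law[OF \<mu>]) (simp add: sgn_div_norm)
  have "(\<lambda>k. \<Sum>i<n k. \<bar>u \<bullet> w k i\<bar> powr \<alpha>) \<longlonglongrightarrow> f u" for u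
  proof -
    define D where "D = real CARD('d)"
    define R where "R = norm u * (1 + D)"
    have in_R: "\<bar>u \<bullet> sgn x\<bar> \<in> {0..R}" "\<bar>u \<bullet> sgn_grid k x\<bar> \<in> {0..R}" for x k
    proof -
      have "norm (sgn x) \<le> 1" by (simp add: norm_sgn)
      moreover have "norm (sgn_grid k x) \<le> norm (sgn x) + norm (sgn_grid k x - sgn x)"
        using norm_triangle_ineq[of "sgn x" "sgn_grid k x - sgn x"] by simp
      moreover have "norm (sgn_grid k x - sgn x) \<le> D"
        using norm_sgn_grid_diff[of k x] by (rule order_trans) (simp add: D_def divide_le_eq)
      moreover have "0 \<le> D" by (simp add: D_def)
      ultimately have "norm (sgn x) \<le> 1 + D" "norm (sgn_grid k x) \<le> 1 + D" by linarith+
      then show "\<bar>u \<bullet> sgn x\<bar> \<in> {0..R}" "\<bar>u \<bullet> sgn_grid k x\<bar> \<in> {0..R}"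
        unfolding R_def atLeastAtMost_iff
        using order_trans[OF Cauchy_Schwarz_ineq2 mult_left_mono[OF _ norm_ge_zero]] abs_ge_zero by blast+
    qed
    have "(\<lambda>k. f u powr (p k / \<alpha>) - (\<Sum>i<n k. \<bar>u \<bullet> w k i\<bar> powr \<alpha>)) \<longlonglongrightarrow> 0"
    proof (rule LIMSEQ_I)
      fix r :: real assume "0 < r"
      define e where "e = r / (2 * (B + 1))"
      have "0 < e" using \<open>0 < r\<close> \<open>0 \<le> B\<close> by (simp add: e_def)
      obtain d where "0 < d" and d: "\<And>s t p. s \<in> {0..R} \<Longrightarrow> t \<in> {0..R} \<Longrightarrow> p \<in> {\<alpha> / 2..\<alpha>} \<Longrightarrow>
          \<bar>s - t\<bar> < d \<Longrightarrow> \<bar>p - \<alpha>\<bar> < d \<Longrightarrow> \<bar>s powr p - t powr \<alpha>\<bar> < e"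
        using powr_uniformly_continuous[OF \<open>0 < \<alpha>\<close> \<open>0 < e\<close>, of R] by blast
      have "(\<lambda>k. norm u * (D / real (Suc k))) \<longlonglongrightarrow> 0" by real_asymp
      then have ev1: "\<forall>\<^sub>F k in sequentially. norm u * (D / real (Suc k)) < d"
        using \<open>0 < d\<close> by (rule order_tendstoD)
      have ev2: "\<forall>\<^sub>F k in sequentially. \<bar>p k - \<alpha>\<bar> < d"
        using tendstoD[OF p_lim \<open>0 < d\<close>] by (simp add: dist_real_def)
      have "\<forall>\<^sub>F k in sequentially. norm (f u powr (p k / \<alpha>) - (\<Sum>i<n k. \<bar>u \<bullet> w k i\<bar> powr \<alpha>) - 0) < r"
        using ev1 ev2
      proof eventually_elim
        case (elim k)
        have close: "\<bar>\<bar>u \<bullet> sgn x\<bar> powr p k - \<bar>u \<bullet> sgn_grid k x\<bar> powr \<alpha>\<bar> < e" for x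
        proof (rule d[OF in_R p(3) _ elim(2)])
          have "\<bar>\<bar>u \<bullet> sgn x\<bar> - \<bar>u \<bullet> sgn_grid k x\<bar>\<bar> \<le> \<bar>u \<bullet> sgn x - u \<bullet> sgn_grid k x\<bar>"
            by (rule abs_triangle_ineq3)
          also have "\<dots> = \<bar>u \<bullet> (sgn_grid k x - sgn x)\<bar>" by (simp add: inner_diff_right abs_minus_commute)
          also have "\<dots> \<le> norm u * norm (sgn_grid k x - sgn x)" by (rule Cauchy_Schwarz_ineq2)
          also have "\<dots> \<le> norm u * (D / real (Suc k))"
            unfolding D_def by (intro mult_left_mono norm_sgn_grid_diff) simp
          finally show "\<bar>\<bar>u \<bullet> sgn x\<bar> - \<bar>u \<bullet> sgn_grid k x\<bar>\<bar> < d" using elim(1) by simp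
        qed
        define Q where "Q x = \<bar>u \<bullet> sgn x\<bar> powr p k" for x
        have polar: "\<bar>u \<bullet> x\<bar> powr p k = norm x powr p k * Q x" for x
        proof -
          have "u \<bullet> x = norm x * (u \<bullet> sgn x)" by (cases "x = 0") (simp_all add: sgn_div_norm)
          then show ?thesis by (simp add: abs_mult powr_mult Q_def)
        qed
        have int1: "integrable \<mu> (\<lambda>x. C k * norm x powr p k * \<bar>u \<bullet> sgn x\<bar> powr p k)"
          using C(2)[of u k] unfolding Q_def[symmetric] by (simp add: polar mult.assoc)
        have int2: "integrable \<mu> (\<lambda>x. C k * norm x powr p k * \<bar>u \<bullet> sgn_grid k x\<bar> powr \<alpha>)"
        proof (rule Bochner_Integration.integrable_bound)
          show "integrable \<mu> (\<lambda>x. C k * norm x powr p k * R powr \<alpha>)" using norm_int by simp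
          show "(\<lambda>x. C k * norm x powr p k * \<bar>u \<bullet> sgn_grid k x\<bar> powr \<alpha>) \<in> borel_measurable \<mu>"
            by (rule measurable_prob_law[OF \<mu>]) measurable
          show "AE x in \<mu>. norm (C k * norm x powr p k * \<bar>u \<bullet> sgn_grid k x\<bar> powr \<alpha>)
              \<le> norm (C k * norm x powr p k * R powr \<alpha>)"
            using in_R(2) \<open>0 < \<alpha>\<close> by (intro AE_I2) (auto simp: abs_mult intro!: mult_left_mono powr_mono2)
        qed
        have "f u powr (p k / \<alpha>) = (LINT x|\<mu>. C k * norm x powr p k * \<bar>u \<bullet> sgn x\<bar> powr p k)"
          unfolding Q_def[symmetric] by (simp add: C(3)[symmetric] polar mult.assoc)
        then have "\<bar>f u powr (p k / \<alpha>) - (\<Sum>i<n k. \<bar>u \<bullet> w k i\<bar> powr \<alpha>)\<bar>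
            = \<bar>LINT x|\<mu>. C k * norm x powr p k * \<bar>u \<bullet> sgn x\<bar> powr p k
                - C k * norm x powr p k * \<bar>u \<bullet> sgn_grid k x\<bar> powr \<alpha>\<bar>"
          using int1 int2 by (simp add: w)
        also have "\<dots> \<le> (LINT x|\<mu>. \<bar>C k * norm x powr p k * \<bar>u \<bullet> sgn x\<bar> powr p k
                - C k * norm x powr p k * \<bar>u \<bullet> sgn_grid k x\<bar> powr \<alpha>\<bar>)"
          by (rule integral_abs_bound)
        also have "\<dots> \<le> (LINT x|\<mu>. C k * norm x powr p k * e)"
        proof (rule integral_mono)
          fix x
          have "\<bar>C k * norm x powr p k * \<bar>u \<bullet> sgn x\<bar> powr p k - C k * norm x powr p k * \<bar>u \<bullet> sgn_grid k x\<bar> powr \<alpha>\<bar>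
              = C k * norm x powr p k * \<bar>\<bar>u \<bullet> sgn x\<bar> powr p k - \<bar>u \<bullet> sgn_grid k x\<bar> powr \<alpha>\<bar>"
            using C(1)[of k] by (simp add: right_diff_distrib[symmetric] abs_mult)
          also have "\<dots> \<le> C k * norm x powr p k * e"
            using close[of x] C(1)[of k] by (intro mult_left_mono) auto
          finally show "\<bar>C k * norm x powr p k * \<bar>u \<bullet> sgn x\<bar> powr p k
              - C k * norm x powr p k * \<bar>u \<bullet> sgn_grid k x\<bar> powr \<alpha>\<bar> \<le> C k * norm x powr p k * e" .
        qed (use int1 int2 norm_int in auto)
        also have "\<dots> = (C k * (LINT x|\<mu>. norm x powr p k)) * e" by simp
        also have "\<dots> \<le> B * e" using norm_le \<open>0 < e\<close> by (intro mult_right_mono) auto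
        also have "\<dots> < r"
        proof -
          have "B * r < 2 * (B + 1) * r" using \<open>0 \<le> B\<close> \<open>0 < r\<close> by (intro mult_strict_right_mono) auto
          then show ?thesis using \<open>0 \<le> B\<close> by (simp add: e_def divide_less_eq mult.commute)
        qed
        finally show ?case by simp
      qed
      then show "\<exists>N. \<forall>k\<ge>N. norm (f u powr (p k / \<alpha>) - (\<Sum>i<n k. \<bar>u \<bullet> w k i\<bar> powr \<alpha>) - 0) < r"
        by (simp add: eventually_sequentially)
    qed
    moreover have "(\<lambda>k. f u powr (p k / \<alpha>)) \<longlonglongrightarrow> f u"
    proof (cases "f u = 0")
      case False
      have "(\<lambda>k. f u powr (p k / \<alpha>)) \<longlonglongrightarrow> f u powr (\<alpha> / \<alpha>)"
        using False \<open>0 < \<alpha>\<close> by (intro tendsto_intros p_lim) auto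
      then show ?thesis using \<open>0 < \<alpha>\<close> f(2)[of u] by simp
    qed simp
    ultimately show ?thesis
      using tendsto_diff[of "\<lambda>k. f u powr (p k / \<alpha>)" "f u" sequentially] by fastforce
  qed
  with n show ?thesis by (rule that)
qed

section \<open>Sums of sub-Gaussian vectors\<close>

lemma powr_add_le:
  fixes a b s :: real
  assumes "0 \<le> a" and "0 \<le> b" and "0 < s" and "s \<le> 1"
  shows "(a + b) powr s \<le> a powr s + b powr s"
proof (cases "a + b = 0")
  case False
  then have "0 < a + b" using assms by simp
  have frac: "x \<le> x powr s" if "0 \<le> x" "x \<le> 1" for x :: real
    using powr_mono'[of s 1 x] that assms by simp
  have "1 = a / (a + b) + b / (a + b)" using False by (simp add: add_divide_distrib[symmetric])
  also have "\<dots> \<le> (a / (a + b)) powr s + (b / (a + b)) powr s"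
    using assms \<open>0 < a + b\<close> by (intro add_mono frac) (auto simp: divide_le_eq)
  also have "\<dots> = (a powr s + b powr s) / (a + b) powr s"
    using assms by (simp add: powr_divide add_divide_distrib)
  finally show ?thesis using \<open>0 < a + b\<close> by (simp add: le_divide_eq)
qed (use assms in auto)

text \<open>A positive definite square root of the quadratic form \<open>(u \<bullet> w)\<^sup>2 + e\<^sup>2 * (norm u)\<^sup>2\<close>: it acts as
  \<open>e\<close> on the orthogonal complement of \<open>w\<close> and as \<open>sqrt (e\<^sup>2 + (norm w)\<^sup>2)\<close> on \<open>w\<close>.\<close>

lemma thin_ellipsoid:
  fixes w :: "real ^ 'd"
  assumes "0 < e"
  obtains B :: "real ^ 'd \<Rightarrow> real ^ 'd" where "linear B" and "inj B"
    and "\<And>u. (norm (B u))\<^sup>2 = (u \<bullet> w)\<^sup>2 + e\<^sup>2 * (norm u)\<^sup>2"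
proof -
  define s where "s = sqrt (e\<^sup>2 + (norm w)\<^sup>2)"
  have s: "s\<^sup>2 = e\<^sup>2 + (norm w)\<^sup>2" "0 \<le> s" by (simp_all add: s_def)
  \<comment> \<open>The nonnegative root of \<open>2 * e * c + c\<^sup>2 * (norm w)\<^sup>2 = 1\<close>, in a form that allows \<open>w = 0\<close>.\<close>
  define c where "c = 1 / (e + s)"
  have "0 < e + s" using \<open>0 < e\<close> s(2) by simp
  have c: "2 * e * c + c\<^sup>2 * (norm w)\<^sup>2 = 1"
  proof -
    have "2 * e * (e + s) + (norm w)\<^sup>2 = (e + s)\<^sup>2"
      using s(1) by (simp add: power2_eq_square algebra_simps)
    moreover have "2 * e * c + c\<^sup>2 * (norm w)\<^sup>2 = (2 * e * (e + s) + (norm w)\<^sup>2) / (e + s)\<^sup>2"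
    proof -
      have "2 * e * (1 / t) + (1 / t)\<^sup>2 * v = (2 * e * t + v) / t\<^sup>2" if "0 < t" for t v :: real
        using that by (simp add: field_simps power2_eq_square)
      then show ?thesis using \<open>0 < e + s\<close> by (simp add: c_def)
    qed
    ultimately show ?thesis using \<open>0 < e + s\<close> by simp
  qed
  define B where "B u = e *\<^sub>R u + (c * (u \<bullet> w)) *\<^sub>R w" for u :: "real ^ 'd"
  have "linear B"
    by (rule linearI) (simp_all add: B_def inner_add_left algebra_simps)
  have norm: "(norm (B u))\<^sup>2 = (u \<bullet> w)\<^sup>2 + e\<^sup>2 * (norm u)\<^sup>2" for u
  proof -
    have "(norm (B u))\<^sup>2 = e\<^sup>2 * (norm u)\<^sup>2 + (2 * e * c + c\<^sup>2 * (norm w)\<^sup>2) * (u \<bullet> w)\<^sup>2"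
      unfolding B_def power2_norm_eq_inner
      by (simp add: inner_add_left inner_add_right inner_commute[of w u] power2_eq_square algebra_simps)
    then show ?thesis by (simp add: c)
  qed
  have "u = 0" if "B u = 0" for u
  proof -
    have "(u \<bullet> w)\<^sup>2 + e\<^sup>2 * (norm u)\<^sup>2 = 0" using norm[of u] that by simp
    then have "e\<^sup>2 * (norm u)\<^sup>2 \<le> 0" using zero_le_power2[of "u \<bullet> w"] by linarith
    then show ?thesis using \<open>0 < e\<close> by (simp add: mult_le_0_iff)
  qed
  then have "inj B" using linear_injective_0[OF \<open>linear B\<close>] by blast
  with \<open>linear B\<close> show ?thesis using norm by (rule that)
qed

text \<open>Since \<open>\<alpha> / 2 \<le> 1\<close>, the power \<open>\<alpha> / 2\<close> of the quadratic form is subadditive.\<close>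

lemma thin_ellipsoid_powr:
  fixes w :: "real ^ 'd"
  assumes "0 < e" and "0 < \<alpha>" and "\<alpha> \<le> 2"
  obtains B :: "real ^ 'd \<Rightarrow> real ^ 'd" where "linear B" and "inj B"
    and "\<And>u. \<bar>u \<bullet> w\<bar> powr \<alpha> \<le> norm (B u) powr \<alpha>"
    and "\<And>u. norm (B u) powr \<alpha> \<le> \<bar>u \<bullet> w\<bar> powr \<alpha> + e powr \<alpha> * norm u powr \<alpha>"
proof -
  obtain B :: "real ^ 'd \<Rightarrow> real ^ 'd" where B: "linear B" "inj B"
    "\<And>u. (norm (B u))\<^sup>2 = (u \<bullet> w)\<^sup>2 + e\<^sup>2 * (norm u)\<^sup>2"
    using thin_ellipsoid[OF \<open>0 < e\<close>, of w] by blast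
  have half: "\<bar>x\<bar> powr \<alpha> = (x\<^sup>2) powr (\<alpha> / 2)" for x :: real
  proof -
    have "x\<^sup>2 = \<bar>x\<bar> powr 2" by simp
    then show ?thesis by (simp only: powr_powr) simp
  qed
  show ?thesis
  proof (rule that[OF B(1,2)])
    fix u
    have eq: "norm (B u) powr \<alpha> = ((u \<bullet> w)\<^sup>2 + (e * norm u)\<^sup>2) powr (\<alpha> / 2)"
      using half[of "norm (B u)"] by (simp add: B(3) power_mult_distrib)
    show "\<bar>u \<bullet> w\<bar> powr \<alpha> \<le> norm (B u) powr \<alpha>"
      unfolding eq half[of "u \<bullet> w"] using \<open>0 < \<alpha>\<close> by (intro powr_mono2) auto
    have "norm (B u) powr \<alpha> \<le> ((u \<bullet> w)\<^sup>2) powr (\<alpha> / 2) + ((e * norm u)\<^sup>2) powr (\<alpha> / 2)"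
      unfolding eq using assms by (intro powr_add_le) auto
    also have "\<dots> = \<bar>u \<bullet> w\<bar> powr \<alpha> + e powr \<alpha> * norm u powr \<alpha>"
      using half[of "e * norm u"] \<open>0 < e\<close> by (simp add: half[of "u \<bullet> w"] abs_mult powr_mult)
    finally show "norm (B u) powr \<alpha> \<le> \<bar>u \<bullet> w\<bar> powr \<alpha> + e powr \<alpha> * norm u powr \<alpha>" .
  qed
qed

lemma sub_Gaussian_sum_near:
  fixes w :: "nat \<Rightarrow> real ^ 'd"
  assumes "0 < \<alpha>" and "\<alpha> \<le> 2" and "0 < n" and "0 < d"
  obtains \<nu> g where "sub_Gaussian_sum \<alpha> \<nu>" and "prob_law \<nu>"
    and "\<And>u. char_fun \<nu> u = complex_of_real (exp (- g u))"
    and "\<And>u. \<bar>g u - (\<Sum>i<n. \<bar>u \<bullet> w i\<bar> powr \<alpha>)\<bar> \<le> d * norm u powr \<alpha>"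
proof -
  define e where "e = (d / real n) powr (1 / \<alpha>)"
  have "0 < e" using \<open>0 < n\<close> \<open>0 < d\<close> by (simp add: e_def)
  have e_powr: "real n * e powr \<alpha> = d"
    using \<open>0 < n\<close> \<open>0 < d\<close> \<open>0 < \<alpha>\<close> by (simp add: e_def powr_powr)
  have "\<exists>B :: real ^ 'd \<Rightarrow> real ^ 'd. linear B \<and> inj B \<and> (\<forall>u. \<bar>u \<bullet> w i\<bar> powr \<alpha> \<le> norm (B u) powr \<alpha> \<and>
      norm (B u) powr \<alpha> \<le> \<bar>u \<bullet> w i\<bar> powr \<alpha> + e powr \<alpha> * norm u powr \<alpha>)" for i
    using thin_ellipsoid_powr[OF \<open>0 < e\<close> assms(1,2), of "w i"] by metis
  then obtain B :: "nat \<Rightarrow> real ^ 'd \<Rightarrow> real ^ 'd" where B: "\<And>i. linear (B i)" "\<And>i. inj (B i)"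
    "\<And>i u. \<bar>u \<bullet> w i\<bar> powr \<alpha> \<le> norm (B i u) powr \<alpha>"
    "\<And>i u. norm (B i u) powr \<alpha> \<le> \<bar>u \<bullet> w i\<bar> powr \<alpha> + e powr \<alpha> * norm u powr \<alpha>"
    by metis
  have "\<exists>\<mu>. sub_Gaussian \<alpha> \<mu> \<and> (\<forall>u. char_fun \<mu> u = complex_of_real (exp (- (norm (B i u) powr \<alpha>))))" for i
    using sub_Gaussian_exists[OF assms(1,2) B(1,2)[of i]] by metis
  then obtain \<mu> where \<mu>: "\<And>i. sub_Gaussian \<alpha> (\<mu> i)"
    "\<And>i u. char_fun (\<mu> i) u = complex_of_real (exp (- (norm (B i u) powr \<alpha>)))"
    by metis
  have law: "prob_law (\<mu> i)" for i using \<mu>(1) by (simp add: sub_Gaussian_def)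
  show ?thesis
  proof
    show "sub_Gaussian_sum \<alpha> (indep_sum_law n \<mu>)"
      unfolding sub_Gaussian_sum_def 
      using \<open>0 < n\<close> \<mu>(1) by (intro exI[of _ n] exI[of _ \<mu>]) simp
    show "prob_law (indep_sum_law n \<mu>)" by (rule char_fun_indep_sum_law(1)[OF law])
    fix u
    show "char_fun (indep_sum_law n \<mu>) u = complex_of_real (exp (- (\<Sum>i<n. norm (B i u) powr \<alpha>)))"
      by (simp add: char_fun_indep_sum_law(2)[OF law] \<mu>(2) exp_sum flip: sum_negf)
    have "(\<Sum>i<n. norm (B i u) powr \<alpha>) \<le> (\<Sum>i<n. \<bar>u \<bullet> w i\<bar> powr \<alpha> + e powr \<alpha> * norm u powr \<alpha>)"
      by (intro sum_mono B(4))
    also have "\<dots> = (\<Sum>i<n. \<bar>u \<bullet> w i\<bar> powr \<alpha>) + d * norm u powr \<alpha>"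
      by (simp add: sum.distrib flip: e_powr)
    finally have "(\<Sum>i<n. norm (B i u) powr \<alpha>) \<le> (\<Sum>i<n. \<bar>u \<bullet> w i\<bar> powr \<alpha>) + d * norm u powr \<alpha>" .
    moreover have "(\<Sum>i<n. \<bar>u \<bullet> w i\<bar> powr \<alpha>) \<le> (\<Sum>i<n. norm (B i u) powr \<alpha>)"
      by (intro sum_mono B(3))
    ultimately show "\<bar>(\<Sum>i<n. norm (B i u) powr \<alpha>) - (\<Sum>i<n. \<bar>u \<bullet> w i\<bar> powr \<alpha>)\<bar> \<le> d * norm u powr \<alpha>"
      by simp
  qed
qed

lemma sub_Gaussian_sum_char_fun:
  fixes \<nu> :: "(real ^ 'd) measure"
  assumes "sub_Gaussian_sum \<alpha> \<nu>" and "0 < \<alpha>"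
  obtains g where "prob_law \<nu>" and "\<And>u. char_fun \<nu> u = complex_of_real (exp (- g u))"
    and "\<And>u. g (- u) = g u" and "\<And>c u. 0 < c \<Longrightarrow> g (c powr (1 / \<alpha>) *\<^sub>R u) = c * g u"
proof -
  obtain n :: nat and \<mu> where n: "0 < n" "\<And>i. i < n \<Longrightarrow> sub_Gaussian \<alpha> (\<mu> i)" and \<nu>: "\<nu> = indep_sum_law n \<mu>"
    using assms(1) unfolding sub_Gaussian_sum_def by blast
  have "\<exists>B :: real ^ 'd \<Rightarrow> real ^ 'd. i < n \<longrightarrow> linear B \<and> prob_law (\<mu> i) \<and>
      (\<forall>u. char_fun (\<mu> i) u = complex_of_real (exp (- (norm (B u) powr \<alpha>))))" for i
    using sub_Gaussian_char_fun[OF n(2)[of i]] by metis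
  then obtain B :: "nat \<Rightarrow> real ^ 'd \<Rightarrow> real ^ 'd" where B: "\<And>i. i < n \<Longrightarrow> linear (B i)"
    "\<And>i. i < n \<Longrightarrow> prob_law (\<mu> i)"
    "\<And>i u. i < n \<Longrightarrow> char_fun (\<mu> i) u = complex_of_real (exp (- (norm (B i u) powr \<alpha>)))"
    by metis
  show ?thesis
  proof
    show "prob_law \<nu>" unfolding \<nu> by (rule char_fun_indep_sum_law(1)[OF B(2)])
    show "char_fun \<nu> u = complex_of_real (exp (- (\<Sum>i<n. norm (B i u) powr \<alpha>)))" for u
      unfolding \<nu> by (simp add: char_fun_indep_sum_law(2)[OF B(2)] B(3) exp_sum flip: sum_negf)
    show "(\<Sum>i<n. norm (B i (- u)) powr \<alpha>) = (\<Sum>i<n. norm (B i u) powr \<alpha>)" for u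
      by (intro sum.cong) (auto simp: linear_neg[OF B(1)])
    show "(\<Sum>i<n. norm (B i (c powr (1 / \<alpha>) *\<^sub>R u)) powr \<alpha>) = c * (\<Sum>i<n. norm (B i u) powr \<alpha>)"
      if "0 < c" for c u
      unfolding sum_distrib_left using that \<open>0 < \<alpha>\<close>
      by (intro sum.cong) (auto simp: linear_cmul[OF B(1)] powr_mult powr_powr)
  qed
qed

section \<open>Stable laws as limits of sums of sub-Gaussian vectors\<close>

lemma sym_stable_imp_limit:
  fixes \<mu> :: "(real ^ 'd) measure"
  assumes "0 < \<alpha>" and "\<alpha> \<le> 2" and \<mu>: "prob_law \<mu>" and "sym_stable \<alpha> \<mu>"
  shows "\<exists>\<nu>. (\<forall>k. sub_Gaussian_sum \<alpha> (\<nu> k)) \<and> weak_limit \<nu> \<mu>"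
proof -
  obtain f where f: "\<And>u. char_fun \<mu> u = complex_of_real (exp (- f u))" "\<And>u. 0 \<le> f u"
    "\<And>c u. 0 < c \<Longrightarrow> f (c *\<^sub>R u) = c powr \<alpha> * f u"
    using stable_exponent[OF \<mu> assms(4,1)] by blast
  obtain n :: "nat \<Rightarrow> nat" and w :: "nat \<Rightarrow> nat \<Rightarrow> real ^ 'd" where n: "\<And>k. 0 < n k"
    and w: "\<And>u. (\<lambda>k. \<Sum>i<n k. \<bar>u \<bullet> w k i\<bar> powr \<alpha>) \<longlonglongrightarrow> f u"
    using stable_exponent_approx[OF \<mu> assms(1,2) f] by blast
  have "\<exists>\<nu> g. sub_Gaussian_sum \<alpha> \<nu> \<and> prob_law \<nu> \<and> (\<forall>u. char_fun \<nu> u = complex_of_real (exp (- g u))) \<and>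
      (\<forall>u. \<bar>g u - (\<Sum>i<n k. \<bar>u \<bullet> w k i\<bar> powr \<alpha>)\<bar> \<le> 1 / real (Suc k) * norm u powr \<alpha>)" for k
  proof -
    have "0 < 1 / real (Suc k)" by simp
    from sub_Gaussian_sum_near[OF assms(1,2) n[of k] this, of "w k"] show ?thesis by metis
  qed
  then obtain \<nu> g where \<nu>: "\<And>k. sub_Gaussian_sum \<alpha> (\<nu> k)" "\<And>k. prob_law (\<nu> k)"
    and g: "\<And>k u. char_fun (\<nu> k) u = complex_of_real (exp (- g k u))"
    "\<And>k u. \<bar>g k u - (\<Sum>i<n k. \<bar>u \<bullet> w k i\<bar> powr \<alpha>)\<bar> \<le> 1 / real (Suc k) * norm u powr \<alpha>"
    by metis
  have "(\<lambda>k. char_fun (\<nu> k) u) \<longlonglongrightarrow> char_fun \<mu> u" for u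
  proof -
    have "(\<lambda>k. 1 / real (Suc k) * norm u powr \<alpha>) \<longlonglongrightarrow> 0" by real_asymp
    then have "(\<lambda>k. g k u - (\<Sum>i<n k. \<bar>u \<bullet> w k i\<bar> powr \<alpha>)) \<longlonglongrightarrow> 0"
      by (rule Lim_null_comparison[rotated]) (use g(2) in simp)
    from tendsto_add[OF this w[of u]] have "(\<lambda>k. g k u) \<longlonglongrightarrow> f u" by simp
    then show ?thesis unfolding g(1) f(1) by (intro tendsto_intros)
  qed
  then have "weak_limit \<nu> \<mu>" by (rule levy_continuity_vec[OF \<nu>(2) \<mu>])
  with \<nu>(1) show ?thesis by blast
qed

lemma limit_imp_sym_stable:
  fixes \<mu> :: "(real ^ 'd) measure"
  assumes "0 < \<alpha>" and \<mu>: "prob_law \<mu>" and sums: "\<And>k. sub_Gaussian_sum \<alpha> (\<nu> k)" and lim: "weak_limit \<nu> \<mu>"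
  shows "sym_stable \<alpha> \<mu>"
proof -
  have "\<exists>g. prob_law (\<nu> k) \<and> (\<forall>u. char_fun (\<nu> k) u = complex_of_real (exp (- g u))) \<and>
      (\<forall>u. g (- u) = g u) \<and> (\<forall>c>0. \<forall>u. g (c powr (1 / \<alpha>) *\<^sub>R u) = c * g u)" for k
    using sub_Gaussian_sum_char_fun[OF sums[of k] \<open>0 < \<alpha>\<close>] by metis
  then obtain g where law: "\<And>k. prob_law (\<nu> k)"
    and g: "\<And>k u. char_fun (\<nu> k) u = complex_of_real (exp (- g k u))"
    and even: "\<And>k u. g k (- u) = g k u"
    and hom: "\<And>k c u. 0 < c \<Longrightarrow> g k (c powr (1 / \<alpha>) *\<^sub>R u) = c * g k u"
    by metis
  have conv: "(\<lambda>k. char_fun (\<nu> k) u) \<longlonglongrightarrow> char_fun \<mu> u" for u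
    by (rule weak_limit_char_fun[OF law \<mu> lim])
  have "char_fun \<mu> (- u) = char_fun \<mu> u" for u
    using conv[of "- u"] conv[of u] unfolding g even by (rule LIMSEQ_unique)
  moreover have "char_fun \<mu> (a powr (1 / \<alpha>) *\<^sub>R u) * char_fun \<mu> (b powr (1 / \<alpha>) *\<^sub>R u)
      = char_fun \<mu> ((a + b) powr (1 / \<alpha>) *\<^sub>R u)" if "0 < a" "0 < b" for a b u
  proof (rule LIMSEQ_unique)
    show "(\<lambda>k. char_fun (\<nu> k) (a powr (1 / \<alpha>) *\<^sub>R u) * char_fun (\<nu> k) (b powr (1 / \<alpha>) *\<^sub>R u))
        \<longlonglongrightarrow> char_fun \<mu> (a powr (1 / \<alpha>) *\<^sub>R u) * char_fun \<mu> (b powr (1 / \<alpha>) *\<^sub>R u)"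
      by (intro tendsto_mult conv)
    have "char_fun (\<nu> k) (a powr (1 / \<alpha>) *\<^sub>R u) * char_fun (\<nu> k) (b powr (1 / \<alpha>) *\<^sub>R u)
        = char_fun (\<nu> k) ((a + b) powr (1 / \<alpha>) *\<^sub>R u)" for k
    proof -
      have "exp (- (a * g k u)) * exp (- (b * g k u)) = exp (- ((a + b) * g k u))"
        by (simp add: exp_add[symmetric] algebra_simps)
      then show ?thesis
        using that unfolding g by (simp only: hom add_pos_pos of_real_mult[symmetric])
    qed
    then show "(\<lambda>k. char_fun (\<nu> k) (a powr (1 / \<alpha>) *\<^sub>R u) * char_fun (\<nu> k) (b powr (1 / \<alpha>) *\<^sub>R u))
        \<longlonglongrightarrow> char_fun \<mu> ((a + b) powr (1 / \<alpha>) *\<^sub>R u)"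
      using conv by simp
  qed
  ultimately show ?thesis by (simp add: sym_stable_iff_char_fun[OF \<mu>])
qed

theorem theorem10p2:
  fixes \<alpha> :: real and \<mu> :: "(real ^ 'd) measure"
  assumes "1 \<le> \<alpha>" and "\<alpha> \<le> 2"
    and "prob_law \<mu>"
  shows "sym_stable \<alpha> \<mu> \<longleftrightarrow>
    (\<exists>\<nu>. (\<forall>k. sub_Gaussian_sum \<alpha> (\<nu> k)) \<and> weak_limit \<nu> \<mu>)"
  using sym_stable_imp_limit[of \<alpha> \<mu>] limit_imp_sym_stable[of \<alpha> \<mu>] assms by auto

end
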